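(* Let $q=p^{e}$ with $p$ an odd prime and $e\ge 1$, and let $l$ be an integer with $0\leq l\leq e-1$ and $2l\mid e$. Let $x_1,x_2$ be positive integers with $(q-1)\mid \mathrm{lcm}(x_{1},x_{2})$ and $\frac{q-1}{p^{l}-1}\mid x_{1}$. Let $n=\frac{r(q-1)}{\gcd(x_{2},q-1)}$, where $r$ is an integer with $1\leq r\leq \frac{q-1}{\gcd(x_{1},q-1)}$. Then for any integer $k$ with $1\leq k\leq \left\lfloor\frac{p^{l}+n}{p^{l}+1}\right\rfloor$: (1) there exists an $[[n,k-h,n-k+1;n-k-h]]_{q}$ MDS EAQECC for any integer $0\leq h\leq k-1$; (2) there exists an $[[n+1,k-h,n-k+2;n-k-h+1]]_{q}$ MDS EAQECC for any integer $0\leq h\leq k$; (3) there exists an $[[n+2,k-h,n-k+3;n-k-h+2]]_{q}$ MDS EAQECC for any integer $0\leq h\leq k-1$.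
   Context: An $[[N,K,d;c]]_q$ entanglement-assisted quantum error-correcting code (EAQECC) encodes $K$ logical qudits (of dimension $q$) into $N$ channel qudits using $c$ maximally entangled pairs shared in advance by sender and receiver, with minimum distance $d$. Formally: the sender holds $K$ information qudits, $N-K-c$ ancilla qudits in state $|0\rangle$, and her halves of $c$ maximally entangled pairs $q^{-1/2}\sum_{a\in\mathbb{F}_q}|a\rangle|a\rangle$ (the other halves being held by the receiver), and applies a unitary to her $N$ qudits; the code $Q$ is the resulting $q^K$-dimensional subspace of $(\mathbb{C}^q)^{\otimes N}\otimes(\mathbb{C}^q)^{\otimes c}$. Errors act only on the $N$ channel qudits (identity on the receiver's $c$ qudits) and have the form $\mathbf{e}=\gamma^{i}T(\mathbf{a})R(\mathbf{b})$ with $\mathbf{a},\mathbf{b}\in\mathbb{F}_q^N$, where $\gamma$ is a complex primitive $p$-th root of unity, $T(\mathbf{a})|\mathbf{v}\rangle=|\mathbf{v}+\mathbf{a}\rangle$ and $R(\mathbf{b})|\mathbf{v}\rangle=\gamma^{\mathrm{tr}_{\mathbb{F}_q/\mathbb{F}_p}(\sum_i b_iv_i)}|\mathbf{v}\rangle$; the weight of $\mathbf{e}$ is $\#\{i:(a_i,b_i)\neq(0,0)\}$. The code has minimum distance $d$ if $d$ is the largest integer such that $\langle \mathbf{u}|\mathbf{e}|\mathbf{v}\rangle=0$ for all $|\mathbf{u}\rangle,|\mathbf{v}\rangle\in Q$ with $\langle\mathbf{u}|\mathbf{v}\rangle=0$ and all errors $\mathbf{e}$ of weight at most $d-1$ (for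 $K=0$, by the usual convention, the condition is instead that $\langle\mathbf{u}|\mathbf{e}|\mathbf{u}\rangle=0$ for the code state and all errors of weight between $1$ and $d-1$). An $[[N,K,d;c]]_q$ EAQECC is called MDS if $N+c-K=2(d-1)$. *)

theory Defs
  imports
    Complex_Main
    "HOL-Computational_Algebra.Primes"
    "HOL-Library.Cardinality"
begin

section \<open>Qudit states and operators\<close>

text \<open>
  The type \<^typ>\<open>'a\<close> is the finite field of \<open>q\<close> elements. The computational basis of \<open>m\<close> qudits is
  indexed by the words of length \<open>m\<close> over \<open>'a\<close>. A state of the \<open>N\<close> channel qudits
  and the \<open>c\<close> qudits of the receiver is its amplitude function on pairs \<open>(v, w)\<close>, where \<open>v\<close> is
  a channel word and \<open>w\<close> a receiver word; it vanishes outside \<open>words N \<times> words c\<close>.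
  An operator \<open>A\<close> on the channel qudits is its matrix: \<open>A v u\<close> is the entry \<open>\<langle>v|A|u\<rangle>\<close>,
  and only the entries with \<open>u, v \<in> words N\<close> are relevant.
\<close>

type_synonym 'a state = "'a list \<times> 'a list \<Rightarrow> complex"
type_synonym 'a channel_op = "'a list \<Rightarrow> 'a list \<Rightarrow> complex"

definition words :: "nat \<Rightarrow> 'a list set" where
  "words m = {v. length v = m}"

definition braket :: "nat \<Rightarrow> nat \<Rightarrow> 'a::finite state \<Rightarrow> 'a state \<Rightarrow> complex" where
  "braket N c u v = (\<Sum>x \<in> words N \<times> words c. cnj (u x) * v x)"

text \<open>The operator \<open>A \<otimes> I\<close>, with the identity acting on the receiver's qudits.\<close>

definition apply_channel :: "nat \<Rightarrow> 'a::finite channel_op \<Rightarrow> 'a state \<Rightarrow> 'a state" where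
  "apply_channel N A \<psi> =
     (\<lambda>(v, w). if v \<in> words N then \<Sum>u\<in>words N. A v u * \<psi> (u, w) else 0)"

definition op_mult :: "nat \<Rightarrow> 'a::finite channel_op \<Rightarrow> 'a channel_op \<Rightarrow> 'a channel_op" where
  "op_mult N A B = (\<lambda>v u. \<Sum>z\<in>words N. A v z * B z u)"

definition adjoint_op :: "'a channel_op \<Rightarrow> 'a channel_op" where
  "adjoint_op A = (\<lambda>v u. cnj (A u v))"

definition unitary_op :: "nat \<Rightarrow> 'a::finite channel_op \<Rightarrow> bool" where
  "unitary_op N U \<longleftrightarrow>
     (\<forall>v\<in>words N. \<forall>u\<in>words N.
        op_mult N (adjoint_op U) U v u = (if v = u then 1 else 0) \<and>
        op_mult N U (adjoint_op U) v u = (if v = u then 1 else 0))"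


section \<open>Errors\<close>

definition primitive_root_of_unity :: "nat \<Rightarrow> complex \<Rightarrow> bool" where
  "primitive_root_of_unity m z \<longleftrightarrow> z ^ m = 1 \<and> (\<forall>j. 0 < j \<and> j < m \<longrightarrow> z ^ j \<noteq> 1)"

text \<open>
  The absolute trace of a field of \<open>p ^ e\<close> elements is \<open>x + x ^ p + \<dots> + x ^ (p ^ (e - 1))\<close>.
  It lies in the prime field, so it is the image of exactly one natural number below \<open>p\<close>; that
  number is used as the exponent of \<open>\<gamma>\<close>.
\<close>

definition prime_degree :: "'a::{finite,field} itself \<Rightarrow> nat" where
  "prime_degree _ = (THE e. CARD('a) = CHAR('a) ^ e)"

definition abs_trace :: "'a::{finite,field} \<Rightarrow> 'a" where
  "abs_trace x = (\<Sum>i<prime_degree TYPE('a). x ^ (CHAR('a) ^ i))"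

definition trace_exponent :: "'a::{finite,field} \<Rightarrow> nat" where
  "trace_exponent x = (THE m. m < CHAR('a) \<and> of_nat m = abs_trace x)"

definition shift_op :: "'a::{finite,field} list \<Rightarrow> 'a channel_op" where
  "shift_op a = (\<lambda>v u. if v = map2 (+) u a then 1 else 0)"

definition phase_op :: "complex \<Rightarrow> 'a::{finite,field} list \<Rightarrow> 'a channel_op" where
  "phase_op \<gamma> b =
     (\<lambda>v u. if v = u then \<gamma> ^ trace_exponent (\<Sum>j<length b. b ! j * u ! j) else 0)"

definition error_op :: "complex \<Rightarrow> nat \<Rightarrow> nat \<Rightarrow> 'a::{finite,field} list \<Rightarrow> 'a list \<Rightarrow> 'a channel_op" where
  "error_op \<gamma> N i a b = (\<lambda>v u. \<gamma> ^ i * op_mult N (shift_op a) (phase_op \<gamma> b) v u)"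

definition error_weight :: "nat \<Rightarrow> 'a::{finite,field} list \<Rightarrow> 'a list \<Rightarrow> nat" where
  "error_weight N a b = card {j. j < N \<and> (a ! j, b ! j) \<noteq> (0, 0)}"


section \<open>Entanglement-assisted codes\<close>

text \<open>The amplitude of \<open>c\<close> maximally entangled pairs at the basis vector \<open>|s\<rangle>|w\<rangle>\<close>.\<close>

definition ebits :: "nat \<Rightarrow> 'a::finite list \<Rightarrow> 'a list \<Rightarrow> complex" where
  "ebits c s w =
     (\<Prod>j<c. if s ! j = w ! j then complex_of_real (1 / sqrt (real CARD('a))) else 0)"

text \<open>
  The state before encoding: \<open>K\<close> information qudits in state \<open>\<phi>\<close>, then \<open>N - K - c\<close> ancillas
  in state \<open>|0\<rangle>\<close>, then the sender's halves of the \<open>c\<close> entangled pairs.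
\<close>

definition initial_state :: "nat \<Rightarrow> nat \<Rightarrow> nat \<Rightarrow> ('a::{finite,field} list \<Rightarrow> complex) \<Rightarrow> 'a state" where
  "initial_state N K c \<phi> =
     (\<lambda>(u, w). if u \<in> words N \<and> w \<in> words c then
         \<phi> (take K u)
         * (if take (N - K - c) (drop K u) = replicate (N - K - c) 0 then 1 else 0)
         * ebits c (drop (N - c) u) w
       else 0)"

definition encoded_space ::
  "nat \<Rightarrow> nat \<Rightarrow> nat \<Rightarrow> 'a::{finite,field} channel_op \<Rightarrow> 'a state set" where
  "encoded_space N K c U = range (\<lambda>\<phi>. apply_channel N U (initial_state N K c \<phi>))"

definition has_distance_ge ::
  "complex \<Rightarrow> nat \<Rightarrow> nat \<Rightarrow> nat \<Rightarrow> 'a::{finite,field} state set \<Rightarrow> nat \<Rightarrow> bool" where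
  "has_distance_ge \<gamma> N K c Q d \<longleftrightarrow>
     (if K = 0 then
        \<forall>u\<in>Q. \<forall>i. \<forall>a\<in>words N. \<forall>b\<in>words N. 1 \<le> error_weight N a b \<and> error_weight N a b < d \<longrightarrow>
          braket N c u (apply_channel N (error_op \<gamma> N i a b) u) = 0
      else
        \<forall>u\<in>Q. \<forall>v\<in>Q. braket N c u v = 0 \<longrightarrow>
          (\<forall>i. \<forall>a\<in>words N. \<forall>b\<in>words N. error_weight N a b < d \<longrightarrow>
            braket N c u (apply_channel N (error_op \<gamma> N i a b) v) = 0))"

definition minimum_distance ::
  "complex \<Rightarrow> nat \<Rightarrow> nat \<Rightarrow> nat \<Rightarrow> 'a::{finite,field} state set \<Rightarrow> nat \<Rightarrow> bool" where
  "minimum_distance \<gamma> N K c Q d \<longleftrightarrow>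
     has_distance_ge \<gamma> N K c Q d \<and> (\<forall>d'>d. \<not> has_distance_ge \<gamma> N K c Q d')"

text \<open>
  \<open>EAQECC \<gamma> N K d c Q\<close>: the space \<open>Q\<close> is an \<open>[[N, K, d; c]]\<close> code over \<open>'a\<close>, for the error
  operators built from the root of unity \<open>\<gamma>\<close>.
\<close>

definition EAQECC ::
  "complex \<Rightarrow> nat \<Rightarrow> nat \<Rightarrow> nat \<Rightarrow> nat \<Rightarrow> 'a::{finite,field} state set \<Rightarrow> bool" where
  "EAQECC \<gamma> N K d c Q \<longleftrightarrow>
     K + c \<le> N \<and>
     (\<exists>U. unitary_op N U \<and> Q = encoded_space N K c U) \<and>
     minimum_distance \<gamma> N K c Q d"

definition MDS_EAQECC ::
  "complex \<Rightarrow> nat \<Rightarrow> nat \<Rightarrow> nat \<Rightarrow> nat \<Rightarrow> 'a::{finite,field} state set \<Rightarrow> bool" where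
  "MDS_EAQECC \<gamma> N K d c Q \<longleftrightarrow>
     EAQECC \<gamma> N K d c Q \<and> int N + int c - int K = 2 * (int d - 1)"

end

theory Submission
  imports
    Defs
    "HOL-Computational_Algebra.Polynomial"
    "HOL-Computational_Algebra.Euclidean_Algorithm"
    "HOL-Number_Theory.Cong"
begin

text \<open>
  Two MDS codes \<open>C\<^sub>1\<close>, \<open>C\<^sub>2\<close> of length \<open>N\<close> and dimension \<open>k\<close> whose
  intersection \<open>C\<^sub>1\<^sup>\<bottom> \<inter> C\<^sub>2\<close> has dimension \<open>h\<close> give, by the CSS construction, an
  \<open>[[N, k - h, N - k + 1; N - k - h]]\<close> code: a bit flip has to lie in \<open>C\<^sub>2\<close> and a phase error in
  \<open>C\<^sub>1\<close> to go undetected. On \<open>N \<le> q\<close> points of the field let \<open>C\<^sub>1\<^sup>\<bottom>\<close> be the polynomials of degree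
  below \<open>N - k\<close> and \<open>C\<^sub>2\<close> the products \<open>s f\<close> with \<open>f\<close> of degree below \<open>k\<close>, where \<open>s\<close> has degree
  \<open>N - k - h\<close> and no root among the points; then the intersection is \<open>s\<close> times the polynomials of
  degree below \<open>h\<close>. For \<open>N = q + 1\<close> the point at infinity is added.
\<close>

section \<open>The trace character\<close>

text \<open>Without shared entanglement \<open>C\<^sub>1\<^sup>\<bottom>\<close> would have to lie
  inside \<open>C\<^sub>2\<close>. Here each dimension of \<open>C\<^sub>1\<^sup>\<bottom>\<close>
  outside the intersection is paid for by one pair, whence \<open>c = N - k - h\<close>, and the
  degree of \<open>s\<close> prescribes \<open>h\<close> freely. The information sits in the
  quotient of \<open>C\<^sub>2\<close> by the intersection, of dimension \<open>k - h\<close>.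

  Since both codes are MDS, a nontrivial error of weight at most \<open>N - k\<close> never even
  acts as a scalar: all its matrix elements between code states vanish. This one statement serves
  both \<open>K > 0\<close> and the convention for \<open>K = 0\<close>. Exactness of the distance
  comes from a word of \<open>C\<^sub>2\<close> of weight \<open>N - k + 1\<close>.

  The obstacle is length. Once every field element is a point, no polynomial of degree 1 is free of
  roots, so \<open>s\<close> is then taken of degree at least 2. The numerical hypotheses yield n
  \<le> q - 1 and 4k \<le> n + 3: the first keeps all lengths at most q + 1, the second leaves room
  for \<open>k + h\<close> and for the degree of \<open>s\<close>.\<close>

lemma power_CARD_eq_self:
  fixes x :: "'a::{finite,field}"
  shows "x ^ CARD('a) = x"
proof (cases "x = 0")
  case True
  then show ?thesis by (simp add: power_0_left)
next
  case False
  let ?U = "UNIV - {0::'a}"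
  have "bij_betw ((*) x) ?U ?U"
    by (rule bij_betw_byWitness[where f' = "\<lambda>y. y / x"]) (use False in auto)
  then have "(\<Prod>y\<in>?U. x * y) = \<Prod>?U"
    by (rule prod.reindex_bij_betw)
  then have "x ^ card ?U * \<Prod>?U = \<Prod>?U"
    by (simp add: prod.distrib)
  then have "x ^ card ?U = 1"
    by (simp add: prod_zero_iff)
  moreover have "CARD('a) = Suc (card ?U)"
    by (rule card_Suc_Diff1[symmetric]) auto
  ultimately show ?thesis by (metis mult.right_neutral power_Suc)
qed

locale trace_character =
  fixes p e :: nat and \<gamma> :: complex and field_type :: "'a::{finite,field} itself"
  assumes prime_p: "prime p"
    and card_field: "CARD('a) = p ^ e"
    and primitive: "primitive_root_of_unity p \<gamma>"
begin

lemma CHAR_eq: "CHAR('a) = p"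
proof -
  have "prime CHAR('a)"
    by (intro prime_CHAR_semidom finite_imp_CHAR_pos) auto
  moreover have "CHAR('a) dvd p ^ e"
  proof -
    \<comment> \<open>Translation by 1 permutes the field; cancelling the equal sums leaves
      \<open>CARD('a)\<close> times 1 equal to 0.\<close>
    have "(\<Sum>x::'a\<in>UNIV. x + 1) = (\<Sum>x\<in>UNIV. x)"
      by (rule sum.reindex_bij_betw, rule bij_betw_byWitness[where f' = "\<lambda>x. x - 1"]) auto
    then have "of_nat CARD('a) = (0::'a)" by (simp add: sum.distrib)
    then show ?thesis unfolding card_field[symmetric] of_nat_eq_0_iff_char_dvd .
  qed
  ultimately show ?thesis
    using prime_p by (meson prime_dvd_power primes_dvd_imp_eq)
qed

lemma prime_degree_eq: "prime_degree TYPE('a) = e"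
  unfolding prime_degree_def card_field CHAR_eq
  using prime_gt_1_nat[OF prime_p] by (intro the_equality) simp_all

lemma abs_trace_eq: "abs_trace (x::'a) = (\<Sum>i<e. x ^ (p ^ i))"
  by (simp add: abs_trace_def prime_degree_eq CHAR_eq)

lemma abs_trace_add: "abs_trace (x + y :: 'a) = abs_trace x + abs_trace y"
  unfolding abs_trace_eq sum.distrib[symmetric]
  by (intro sum.cong refl freshmans_dream') (use CHAR_eq prime_p in auto)

lemma exponent_pos: "e > 0"
proof (rule ccontr)
  assume "\<not> e > 0"
  then have "CARD('a) = 1" using card_field by simp
  moreover have "card {0, 1 :: 'a} \<le> CARD('a)" by (rule card_mono) auto
  ultimately show False by simp
qed

text \<open>Frobenius shifts the terms of the trace cyclically: the last one becomes
  \<open>x ^ (p ^ e) = x\<close>. Adding \<open>x\<close> to both sides avoids splitting off the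
  first term.\<close>

lemma abs_trace_power: "abs_trace (x::'a) ^ p = abs_trace x"
proof -
  have "abs_trace x ^ p = (\<Sum>i<e. x ^ (p ^ Suc i))"
    unfolding abs_trace_eq
    by (subst freshmans_dream_sum) (use CHAR_eq prime_p in \<open>auto simp: power_mult[symmetric] mult.commute\<close>)
  also have "\<dots> + x = (\<Sum>i<Suc e. x ^ (p ^ i))"
    unfolding sum.lessThan_Suc_shift by simp
  also have "\<dots> = abs_trace x + x"
    unfolding abs_trace_eq using power_CARD_eq_self[of x] by (simp add: card_field)
  finally show ?thesis by simp
qed

text \<open>Both sides are the full set of roots of \<open>X ^ p - X\<close>.\<close>

lemma frobenius_fixed_eq_prime_field: "{x::'a. x ^ p = x} = of_nat ` {..<p}"
proof (rule sym, rule card_seteq)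
  let ?f = "monom 1 p + [:0, -1:] :: 'a poly"
  have p1: "p > 1" using prime_p prime_gt_1_nat by blast
  have deg: "degree ?f = p"
    using p1 by (subst degree_add_eq_left) (auto simp: degree_monom_eq)
  then have "?f \<noteq> 0" using p1 by auto
  then have "card {x. poly ?f x = 0} \<le> p"
    using card_poly_roots_bound[of ?f] deg by simp
  moreover have "inj_on (of_nat :: nat \<Rightarrow> 'a) {..<p}"
    by (rule inj_onI) (auto simp: of_nat_eq_iff_cong_CHAR CHAR_eq cong_def)
  ultimately show "card {x::'a. x ^ p = x} \<le> card ((of_nat :: nat \<Rightarrow> 'a) ` {..<p})"
    by (simp add: card_image poly_monom)
  have "of_nat m ^ p = (of_nat m :: 'a)" for m
  proof (induction m)
    case (Suc m)
    have "(1 + of_nat m :: 'a) ^ p = 1 ^ p + of_nat m ^ p"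
      by (rule freshmans_dream) (use CHAR_eq prime_p in auto)
    then show ?case using Suc by simp
  qed (use p1 in auto)
  then show "of_nat ` {..<p} \<subseteq> {x::'a. x ^ p = x}" by auto
qed simp

text \<open>The trace is fixed by Frobenius, hence lies in the prime field, so the definite
  description behind \<open>trace_exponent\<close> does denote.\<close>

lemma trace_exponent_props:
  "trace_exponent (x::'a) < p" "of_nat (trace_exponent x) = abs_trace x"
proof -
  have "abs_trace x \<in> of_nat ` {..<p}"
    using abs_trace_power[of x] frobenius_fixed_eq_prime_field by blast
  then have "\<exists>!m. m < CHAR('a) \<and> of_nat m = abs_trace x"
    by (auto simp: CHAR_eq of_nat_eq_iff_cong_CHAR cong_def)
  from theI'[OF this] show "trace_exponent x < p" "of_nat (trace_exponent x) = abs_trace x"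
    by (simp_all add: trace_exponent_def CHAR_eq)
qed

definition chi :: "'a \<Rightarrow> complex" where
  "chi x = \<gamma> ^ trace_exponent x"

lemma gamma_power: "\<gamma> ^ p = 1"
  using primitive by (simp add: primitive_root_of_unity_def)

lemma gamma_power_mod: "\<gamma> ^ (m mod p) = \<gamma> ^ m"
proof -
  have "\<gamma> ^ m = \<gamma> ^ (p * (m div p) + m mod p)" by simp
  also have "\<dots> = \<gamma> ^ (m mod p)"
    unfolding power_add power_mult gamma_power by simp
  finally show ?thesis by simp
qed

text \<open>Trace exponents add only modulo \<open>p\<close>; \<gamma> having order \<open>p\<close>
  absorbs the difference.\<close>

lemma chi_add: "chi (x + y) = chi x * chi y"
proof -
  have "of_nat (trace_exponent (x + y)) = (of_nat (trace_exponent x + trace_exponent y) :: 'a)"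
    unfolding of_nat_add trace_exponent_props abs_trace_add ..
  then have "trace_exponent (x + y) mod p = (trace_exponent x + trace_exponent y) mod p"
    unfolding of_nat_eq_iff_cong_CHAR CHAR_eq cong_def .
  then show ?thesis
    unfolding chi_def power_add[symmetric] by (metis gamma_power_mod)
qed

lemma norm_gamma: "norm \<gamma> = 1"
proof -
  have "norm \<gamma> ^ p = 1 ^ p"
    using gamma_power by (metis norm_one norm_power power_one)
  then show ?thesis
    using prime_gt_0_nat[OF prime_p] by (subst (asm) power_eq_iff_eq_base) auto
qed

lemma norm_chi: "norm (chi x) = 1"
  by (simp add: chi_def norm_power norm_gamma)

lemma chi_0 [simp]: "chi 0 = 1"
  using chi_add[of 0 0] norm_chi[of 0] by auto

lemma cnj_chi_mult_chi: "cnj (chi x) * chi y = chi (y - x)"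
proof -
  have "chi y = chi x * chi (y - x)"
    using chi_add[of x "y - x"] by simp
  moreover have "cnj (chi x) * chi x = 1"
    by (metis complex_norm_square mult.commute norm_chi of_real_1 power_one)
  ultimately show ?thesis by (simp add: mult.assoc[symmetric])
qed

text \<open>The trace is a nonzero polynomial of degree below the size of the field.\<close>

lemma chi_nontrivial: "\<exists>x. chi x \<noteq> 1"
proof -
  let ?f = "\<Sum>i<e. monom 1 (p ^ i) :: 'a poly"
  have p1: "p > 1" using prime_p prime_gt_1_nat by blast
  have "degree ?f \<le> p ^ (e - 1)"
    by (rule degree_sum_le) (use p1 in \<open>auto simp: degree_monom_eq intro!: power_increasing\<close>)
  also have "\<dots> < p ^ e" using p1 exponent_pos by simp
  finally have deg: "degree ?f < CARD('a)" by (simp add: card_field)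
  have "coeff ?f 1 = (\<Sum>i<e. if i = 0 then 1 else 0)"
    unfolding coeff_sum using p1 by (intro sum.cong) (auto simp: coeff_monom)
  then have "?f \<noteq> 0" using exponent_pos by auto
  then have "card {x. poly ?f x = 0} < CARD('a)"
    using card_poly_roots_bound deg le_less_trans by blast
  then obtain x where "poly ?f x \<noteq> 0"
    by (metis (mono_tags, lifting) UNIV_eq_I mem_Collect_eq less_irrefl)
  then have "abs_trace x \<noteq> 0"
    by (simp add: abs_trace_eq poly_sum poly_monom)
  then have "0 < trace_exponent x"
    using trace_exponent_props(2)[of x] by (metis gr0I of_nat_0)
  then have "chi x \<noteq> 1"
    using primitive trace_exponent_props(1)[of x]
    by (simp add: primitive_root_of_unity_def chi_def)
  then show ?thesis by blast
qed

lemma chi_mult_nontrivial: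
  assumes "g \<noteq> 0"
  obtains c where "chi (c * g) \<noteq> 1"
proof -
  obtain x where "chi x \<noteq> 1" using chi_nontrivial by blast
  then show ?thesis using that[of "x / g"] assms by simp
qed

end

section \<open>CSS codes with entanglement assistance\<close>

abbreviation word_add :: "'a::plus list \<Rightarrow> 'a list \<Rightarrow> 'a list" (infixl \<open>\<oplus>\<close> 65) where
  "u \<oplus> v \<equiv> map2 (+) u v"

abbreviation zero_word :: "nat \<Rightarrow> 'a::zero list" where
  "zero_word m \<equiv> replicate m 0"

lemma finite_words [simp]: "finite (words m :: 'a::finite list set)"
  using finite_lists_length_eq[of "UNIV :: 'a set" m] by (simp add: words_def)

lemma length_in_words: "u \<in> words m \<Longrightarrow> length u = m"
  by (simp add: words_def)

lemma word_add_in_words [simp]: "u \<in> words m \<Longrightarrow> v \<in> words m \<Longrightarrow> u \<oplus> v \<in> words m"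
  by (simp add: words_def)

lemma zero_word_in_words [simp]: "zero_word m \<in> words m"
  by (simp add: words_def)

lemma nth_word_add [simp]:
  "u \<in> words m \<Longrightarrow> v \<in> words m \<Longrightarrow> j < m \<Longrightarrow> (u \<oplus> v) ! j = u ! j + v ! j"
  by (simp add: words_def)

lemma word_add_zero [simp]: "u \<in> words m \<Longrightarrow> u \<oplus> zero_word m = (u :: 'a::monoid_add list)"
  by (rule nth_equalityI) (auto simp: words_def)

lemma word_eqI:
  "u \<in> words m \<Longrightarrow> v \<in> words m \<Longrightarrow> (\<And>j. j < m \<Longrightarrow> u ! j = v ! j) \<Longrightarrow> u = v"
  by (rule nth_equalityI) (auto simp: words_def)

lemma bij_betw_word_add:
  fixes w :: "'a::group_add list"
  assumes "w \<in> words m"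
  shows "bij_betw (\<lambda>u. u \<oplus> w) (words m) (words m)"
proof (rule bij_betw_byWitness[where f' = "\<lambda>u. map2 (-) u w"])
  show "\<forall>u\<in>words m. map2 (-) (u \<oplus> w) w = u" "\<forall>u\<in>words m. map2 (-) u w \<oplus> w = u"
    using assms by (auto simp: words_def intro!: nth_equalityI)
qed (use assms in \<open>auto simp: words_def\<close>)

lemma error_weight_le:
  assumes "{j. j < N \<and> (a ! j, b ! j) \<noteq> (0, 0)} \<subseteq> S" "finite S"
  shows "error_weight N a b \<le> card S"
  unfolding error_weight_def using assms by (rule card_mono[rotated])

lemma braket_eq:
  "braket N c \<psi> \<psi>' = (\<Sum>v\<in>words N. \<Sum>w\<in>words c. cnj (\<psi> (v, w)) * \<psi>' (v, w))"
  by (simp add: braket_def sum.cartesian_product split_def)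

context trace_character
begin

text \<open>Reindexing by the translation \<open>w\<close> multiplies the sum by
  \<open>chi t\<close>, which is not 1. Both the unitarity of the Fourier transform and the
  detection of phase errors rest on this cancellation.\<close>

lemma sum_chi_translation_zero:
  fixes w :: "'a list"
  assumes w: "w \<in> words m"
    and G: "\<And>u. u \<in> words m \<Longrightarrow> G (u \<oplus> w) = G u"
    and f: "\<And>u. u \<in> words m \<Longrightarrow> f (u \<oplus> w) = f u + t"
    and t: "chi t \<noteq> 1"
  shows "(\<Sum>u\<in>words m. G u * chi (f u)) = 0"
proof -
  let ?S = "\<Sum>u\<in>words m. G u * chi (f u)"
  have "?S = (\<Sum>u\<in>words m. G (u \<oplus> w) * chi (f (u \<oplus> w)))"
    by (rule sum.reindex_bij_betw[OF bij_betw_word_add[OF w], symmetric])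
  also have "\<dots> = (\<Sum>u\<in>words m. G u * chi (f u) * chi t)"
    by (intro sum.cong refl) (simp only: G f chi_add mult.assoc)
  also have "\<dots> = ?S * chi t" by (simp add: sum_distrib_right)
  finally show ?thesis using t by auto
qed

end

definition dot :: "nat \<Rightarrow> 'a::semiring_0 list \<Rightarrow> 'a list \<Rightarrow> 'a" where
  "dot m b u = (\<Sum>j<m. b ! j * u ! j)"

lemma dot_add:
  "u \<in> words m \<Longrightarrow> v \<in> words m \<Longrightarrow> dot m b (u \<oplus> v) = dot m b u + dot m b v"
  by (simp add: dot_def distrib_left sum.distrib)

lemma dot_scale:
  fixes b :: "'a::comm_semiring_0 list"
  shows "u \<in> words m \<Longrightarrow> dot m b (map ((*) a) u) = a * dot m b u"
  by (simp add: dot_def words_def sum_distrib_left mult.left_commute)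

lemma ebits_eq:
  assumes "s \<in> words c" "w \<in> words c"
  shows "ebits c s (w :: 'a::finite list) =
    (if s = w then complex_of_real (1 / sqrt (real CARD('a))) ^ c else 0)"
proof (cases "s = w")
  case False
  then obtain j where "j < c" "s ! j \<noteq> w ! j" using word_eqI[OF assms] by blast
  then show ?thesis using False by (auto simp: ebits_def intro!: prod_zero)
qed (simp add: ebits_def)

text \<open>
  The qudits entering the encoder are, in this order, \<open>K\<close> information qudits, two blocks of \<open>h\<close>
  ancillas and \<open>c\<close> halves of entangled pairs. The first ancilla block is sent through a Fourier
  transform; then the linear bijection \<open>enc\<close> permutes the basis states. Bit flips act trivially
  or as logical operators only on the image of information and first ancilla block, phase errors
  must be orthogonal to the image of first ancilla block and entangled halves.
\<close>

locale css_encoding = trace_character p e \<gamma> field_type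
  for p e \<gamma> and field_type :: "'a::{finite,field} itself" +
  fixes N K h c d :: nat and enc :: "'a list \<Rightarrow> 'a list"
  assumes N_eq: "N = K + 2 * h + c"
    and enc_words: "\<And>u. u \<in> words N \<Longrightarrow> enc u \<in> words N"
    and enc_inj: "inj_on enc (words N)"
    and enc_add: "\<And>u v. u \<in> words N \<Longrightarrow> v \<in> words N \<Longrightarrow> enc (u \<oplus> v) = enc u \<oplus> enc v"
    and enc_scale: "\<And>a u. u \<in> words N \<Longrightarrow> enc (map ((*) a) u) = map ((*) a) (enc u)"
    and bit_flip_distance: "\<And>u. u \<in> words N \<Longrightarrow> (\<And>j. K + h \<le> j \<Longrightarrow> j < N \<Longrightarrow> u ! j = 0)
      \<Longrightarrow> error_weight N (enc u) (zero_word N) < d \<Longrightarrow> u = zero_word N"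
    and phase_distance: "\<And>b. b \<in> words N \<Longrightarrow> b \<noteq> zero_word N \<Longrightarrow>
      error_weight N (zero_word N) b < d \<Longrightarrow>
      \<exists>u\<in>words N. (\<forall>j<N. j < K \<or> K + h \<le> j \<and> j < K + 2 * h \<longrightarrow> u ! j = 0) \<and> dot N b (enc u) \<noteq> 0"
    and low_weight: "\<exists>u\<in>words N. (\<forall>j. K + h \<le> j \<and> j < N \<longrightarrow> u ! j = 0) \<and> u \<noteq> zero_word N \<and>
      (0 < K \<longrightarrow> take K u \<noteq> zero_word K) \<and> error_weight N (enc u) (zero_word N) \<le> d"
begin

section \<open>The unitary encoder\<close>

definition agree :: "'a list \<Rightarrow> 'a list \<Rightarrow> bool" where
  "agree v u \<longleftrightarrow> (\<forall>j<N. j < K \<or> K + h \<le> j \<longrightarrow> v ! j = u ! j)"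

text \<open>The set counted has q^h elements; leaving it as a cardinality lets unitarity be proved
  without evaluating it.\<close>

definition fourier_scale :: real where
  "fourier_scale = 1 / sqrt (real (card {z \<in> words N. agree z (zero_word N)}))"

text \<open>The quantum Fourier transform on the first ancilla block, tensored with the identity
  elsewhere, which is what \<open>agree\<close> expresses.\<close>

definition fourier :: "'a channel_op" where
  "fourier v u = (if agree v u then complex_of_real fourier_scale * chi (\<Sum>j\<in>{K..<K + h}. v ! j * u ! j) else 0)"

definition dec :: "'a list \<Rightarrow> 'a list" where
  "dec = inv_into (words N) enc"

definition encoder :: "'a channel_op" where
  "encoder v u = fourier (dec v) u"

lemma enc_bij: "bij_betw enc (words N) (words N)"
  unfolding bij_betw_def using enc_words enc_inj by (metis endo_inj_surj finite_words image_subsetI)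

lemma dec_enc [simp]: "u \<in> words N \<Longrightarrow> dec (enc u) = u"
  by (simp add: dec_def enc_inj)

lemma enc_dec [simp]: "v \<in> words N \<Longrightarrow> enc (dec v) = v"
  using enc_bij by (simp add: dec_def bij_betw_def f_inv_into_f)

lemma dec_words [simp]: "v \<in> words N \<Longrightarrow> dec v \<in> words N"
  using enc_bij by (metis dec_def bij_betw_def inv_into_into)

lemma fourier_sym: "fourier v u = fourier u v"
  by (auto simp: fourier_def agree_def mult.commute)

lemma card_agree:
  assumes "u \<in> words N"
  shows "card {z \<in> words N. agree z u} = card {z \<in> words N. agree z (zero_word N)}"
proof (rule bij_betw_same_card[symmetric])
  have "bij_betw (\<lambda>z. z \<oplus> u) (words N) (words N)"
    by (rule bij_betw_word_add[OF assms])
  then show "bij_betw (\<lambda>z. z \<oplus> u) {z \<in> words N. agree z (zero_word N)} {z \<in> words N. agree z u}"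
    by (rule bij_betw_Collect) (use assms in \<open>auto simp: agree_def\<close>)
qed

lemma fourier_scale_square: "fourier_scale\<^sup>2 * card {z \<in> words N. agree z (zero_word N)} = 1"
proof -
  let ?A = "{z \<in> words N. agree z (zero_word N)}"
  have "zero_word N \<in> ?A" by (simp add: agree_def)
  moreover have "finite ?A" by simp
  moreover define m where "m = card ?A"
  ultimately have "m > 0" using card_gt_0_iff by blast
  then show ?thesis by (simp add: fourier_scale_def power_divide flip: m_def)
qed

text \<open>Columns differing outside the transformed block have disjoint supports. If they differ
  at a position \<open>j\<close> of the block, changing \<open>z\<close> in that coordinate alone
  keeps the support and multiplies the summand by a nontrivial character value.\<close>

lemma fourier_orthogonal:
  assumes v: "v \<in> words N" and u: "u \<in> words N"
  shows "(\<Sum>z\<in>words N. cnj (fourier z v) * fourier z u) = (if v = u then 1 else 0)"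
proof -
  define G where
    "G z = (if agree z v \<and> agree z u then complex_of_real (fourier_scale\<^sup>2) else 0)" for z
  define f where "f z = (\<Sum>j\<in>{K..<K + h}. z ! j * (u ! j - v ! j))" for z
  have term_eq: "cnj (fourier z v) * fourier z u = G z * chi (f z)" for z
  proof -
    have "cnj (chi (\<Sum>j\<in>{K..<K + h}. z ! j * v ! j)) * chi (\<Sum>j\<in>{K..<K + h}. z ! j * u ! j) = chi (f z)"
      unfolding cnj_chi_mult_chi f_def by (simp add: sum_subtractf right_diff_distrib)
    then show ?thesis
      by (auto simp: fourier_def G_def power2_eq_square mult_ac)
  qed
  show ?thesis
  proof (cases "v = u")
    case True
    have "(\<Sum>z\<in>words N. G z * chi (f z)) = (\<Sum>z\<in>words N. G z)"
      by (simp add: f_def True)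
    also have "\<dots> = of_nat (card {z \<in> words N. agree z u}) * complex_of_real (fourier_scale\<^sup>2)"
      by (simp add: G_def True flip: sum.inter_filter)
    also have "\<dots> = complex_of_real (fourier_scale\<^sup>2 * card {z \<in> words N. agree z (zero_word N)})"
      by (simp add: card_agree[OF u])
    finally show ?thesis unfolding term_eq fourier_scale_square using True by simp
  next
    case False
    then obtain j where j: "j < N" "v ! j \<noteq> u ! j" using word_eqI[OF v u] by blast
    show ?thesis
    proof (cases "K \<le> j \<and> j < K + h")
      case True
      obtain t where t: "chi (t * (u ! j - v ! j)) \<noteq> 1"
        using j chi_mult_nontrivial[of "u ! j - v ! j"] by auto
      define w where "w = (zero_word N)[j := t]"
      have w: "w \<in> words N" by (simp add: w_def words_def)
      have w_nth: "w ! i = (if i = j then t else 0)" if "i < N" for i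
        using that by (simp add: w_def)
      have "(\<Sum>z\<in>words N. G z * chi (f z)) = 0"
      proof (rule sum_chi_translation_zero[OF w _ _ t])
        fix z :: "'a list" assume z: "z \<in> words N"
        show "G (z \<oplus> w) = G z"
          using z w True by (simp add: G_def agree_def w_nth cong: conj_cong imp_cong)
        have "f (z \<oplus> w) = f z + (\<Sum>i\<in>{K..<K + h}. w ! i * (u ! i - v ! i))"
          unfolding f_def sum.distrib[symmetric]
          by (intro sum.cong refl) (use z w N_eq in \<open>simp add: distrib_right\<close>)
        also have "(\<Sum>i\<in>{K..<K + h}. w ! i * (u ! i - v ! i)) =
            (\<Sum>i\<in>{K..<K + h}. if i = j then t * (u ! j - v ! j) else 0)"
          by (intro sum.cong refl) (use N_eq in \<open>simp add: w_nth\<close>)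
        also have "\<dots> = t * (u ! j - v ! j)" using True by simp
        finally show "f (z \<oplus> w) = f z + t * (u ! j - v ! j)" .
      qed
      then show ?thesis using \<open>v \<noteq> u\<close> by (simp only: term_eq) simp
    next
      case False
      then have "G z = 0" for z using j by (auto simp: G_def agree_def)
      then show ?thesis using \<open>v \<noteq> u\<close> by (simp only: term_eq) simp
    qed
  qed
qed

lemma unitary_encoder: "unitary_op N encoder"
  unfolding unitary_op_def
proof (intro ballI conjI)
  fix v u :: "'a list" assume v: "v \<in> words N" and u: "u \<in> words N"
  have "op_mult N (adjoint_op encoder) encoder v u =
      (\<Sum>z\<in>words N. cnj (fourier (dec z) v) * fourier (dec z) u)"
    by (simp add: op_mult_def adjoint_op_def encoder_def)
  also have "\<dots> = (\<Sum>z\<in>words N. cnj (fourier (dec (enc z)) v) * fourier (dec (enc z)) u)"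
    by (rule sum.reindex_bij_betw[OF enc_bij, symmetric])
  also have "\<dots> = (if v = u then 1 else 0)"
    using fourier_orthogonal[OF v u] by simp
  finally show "op_mult N (adjoint_op encoder) encoder v u = (if v = u then 1 else 0)" .
  \<comment> \<open>Symmetry of the Fourier matrix turns orthogonality of rows into that of
    columns.\<close>
  have "op_mult N encoder (adjoint_op encoder) v u =
      (\<Sum>z\<in>words N. cnj (fourier z (dec u)) * fourier z (dec v))"
    by (simp add: op_mult_def adjoint_op_def encoder_def fourier_sym mult.commute)
  also have "\<dots> = (if dec u = dec v then 1 else 0)"
    using u v by (intro fourier_orthogonal) auto
  also have "dec u = dec v \<longleftrightarrow> v = u" using u v by (metis enc_dec)
  finally show "op_mult N encoder (adjoint_op encoder) v u = (if v = u then 1 else 0)" .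
qed

section \<open>Amplitudes of the code states\<close>

definition amplitude_scale :: real where
  "amplitude_scale = fourier_scale * (1 / sqrt (real CARD('a))) ^ c"

lemma amplitude_scale_nonzero: "amplitude_scale \<noteq> 0"
  using fourier_scale_square by (auto simp: amplitude_scale_def)

text \<open>Only the second ancilla block is tested: the first has become a uniform superposition
  under the Fourier transform.\<close>

definition ancilla_zero :: "'a list \<Rightarrow> bool" where
  "ancilla_zero u \<longleftrightarrow> (\<forall>j. K + h \<le> j \<and> j < K + 2 * h \<longrightarrow> u ! j = 0)"

definition amplitude :: "('a list \<Rightarrow> complex) \<Rightarrow> 'a list \<Rightarrow> 'a list \<Rightarrow> complex" where
  "amplitude \<phi> u w =
     (if ancilla_zero u \<and> drop (N - c) u = w then complex_of_real amplitude_scale * \<phi> (take K u) else 0)"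

definition encoded :: "('a list \<Rightarrow> complex) \<Rightarrow> 'a state" where
  "encoded \<phi> = apply_channel N encoder (initial_state N K c \<phi>)"

text \<open>A single initial basis word \<open>u0\<close> contributes: its information is forced by
  \<open>u\<close>, its ancillas are 0 and its entangled halves equal \<open>w\<close>. Being 0 on
  the first ancilla block, it picks up no phase, so the amplitude does not depend on that block of
  \<open>u\<close>.\<close>

lemma encoded_enc:
  assumes u: "u \<in> words N" and w: "w \<in> words c"
  shows "encoded \<phi> (enc u, w) = amplitude \<phi> u w"
proof -
  define u0 where "u0 = take K u @ zero_word (2 * h) @ w"
  have u0: "u0 \<in> words N" using u w N_eq by (simp add: u0_def words_def)
  have len: "length u = N" "length w = c" using u w by (simp_all add: words_def)
  have NK: "N - (K + c) = 2 * h" "N - c = K + 2 * h" using N_eq by auto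
  have u0_nth: "u0 ! j = (if j < K then u ! j else if j < K + 2 * h then 0 else w ! (j - (K + 2 * h)))"
    if "j < N" for j
    using that len N_eq by (auto simp: u0_def nth_append min_def)
  have u0_props: "take K u0 = take K u" "take (2 * h) (drop K u0) = zero_word (2 * h)"
    "drop (K + 2 * h) u0 = w"
    using len N_eq by (auto simp: u0_def min_def)
  have other: "fourier u x * initial_state N K c \<phi> (x, w) = 0"
    if x: "x \<in> words N" "x \<noteq> u0" for x
  proof (rule ccontr)
    assume nz: "\<not> ?thesis"
    then have ag: "agree u x" by (auto simp: fourier_def split: if_splits)
    have mid: "take (2 * h) (drop K x) = zero_word (2 * h)"
      using nz w x NK by (auto simp: initial_state_def split: if_splits)
    have "drop (N - c) x \<in> words c" using x N_eq by (simp add: words_def)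
    then have last: "drop (K + 2 * h) x = w"
      using nz w x NK by (auto simp: initial_state_def ebits_eq split: if_splits)
    have "x ! j = u ! j" if "j < K" for j
    proof -
      have "j < N" using that N_eq by linarith
      then show ?thesis using ag that by (simp add: agree_def)
    qed
    then have "take K x = take K u"
      using x len N_eq by (intro nth_equalityI) (auto simp: words_def)
    moreover have "x = take K x @ take (2 * h) (drop K x) @ drop (2 * h) (drop K x)"
      by (simp only: append_take_drop_id)
    moreover have "drop (2 * h) (drop K x) = w" using last by (simp add: add.commute)
    ultimately have "x = u0" using mid by (simp add: u0_def)
    then show False using x by simp
  qed
  have "encoded \<phi> (enc u, w) = (\<Sum>x\<in>words N. fourier u x * initial_state N K c \<phi> (x, w))"
    using u enc_words by (simp add: encoded_def apply_channel_def encoder_def)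
  also have "\<dots> = (\<Sum>x\<in>{u0}. fourier u x * initial_state N K c \<phi> (x, w))"
    by (rule sum.mono_neutral_right) (use u0 other in auto)
  also have "\<dots> = fourier u u0 * (\<phi> (take K u) * complex_of_real (1 / sqrt (real CARD('a))) ^ c)"
    using u0 w by (simp add: initial_state_def NK u0_props ebits_eq)
  also have "fourier u u0 = (if ancilla_zero u \<and> drop (N - c) u = w then complex_of_real fourier_scale else 0)"
  proof -
    have le: "K + 2 * h \<le> N" using N_eq by simp
    have "agree u u0 \<longleftrightarrow> ancilla_zero u \<and> drop (N - c) u = w"
    proof
      assume ag: "agree u u0"
      have "ancilla_zero u"
        using ag u0_nth le by (auto simp: agree_def ancilla_zero_def)
      moreover have "drop (N - c) u = w"
      proof (rule nth_equalityI)
        show "length (drop (N - c) u) = length w" using len N_eq by simp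
      qed (use ag u0_nth NK len le in \<open>auto simp: agree_def\<close>)
      ultimately show "ancilla_zero u \<and> drop (N - c) u = w" ..
    next
      assume r: "ancilla_zero u \<and> drop (N - c) u = w"
      show "agree u u0"
        unfolding agree_def
      proof (intro allI impI)
        fix j assume j: "j < N" "j < K \<or> K + h \<le> j"
        have "w ! (j - (K + 2 * h)) = u ! j" if "K + 2 * h \<le> j"
          using r that j len NK by auto
        then show "u ! j = u0 ! j"
          using r j by (auto simp: u0_nth ancilla_zero_def)
      qed
    qed
    moreover have "(\<Sum>j\<in>{K..<K + h}. u ! j * u0 ! j) = 0"
      by (intro sum.neutral) (use u0_nth N_eq in auto)
    ultimately show ?thesis by (simp add: fourier_def)
  qed
  finally show ?thesis by (simp add: amplitude_def amplitude_scale_def)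
qed

section \<open>Matrix elements of errors between code states\<close>

lemma error_op_eq:
  assumes "b \<in> words N" "u \<in> words N"
  shows "error_op \<gamma> N i a b v u = (if v = u \<oplus> a then \<gamma> ^ i * chi (dot N b u) else 0)"
proof -
  have "op_mult N (shift_op a) (phase_op \<gamma> b) v u =
      (\<Sum>z\<in>words N. if z = u then (if v = u \<oplus> a then chi (dot N b u) else 0) else 0)"
    unfolding op_mult_def using assms
    by (intro sum.cong refl) (auto simp: shift_op_def phase_op_def chi_def dot_def length_in_words)
  then show ?thesis using assms by (simp add: error_op_def)
qed

text \<open>Summation is moved to the coordinates before \<open>enc\<close>, where additivity turns
  the channel shift \<open>enc a\<close> into the shift \<open>a\<close>.\<close>

lemma braket_error:
  assumes a: "a \<in> words N" and b: "b \<in> words N"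
  shows "braket N c (encoded \<phi>) (apply_channel N (error_op \<gamma> N i (enc a) b) (encoded \<phi>')) =
    \<gamma> ^ i * (\<Sum>u\<in>words N. \<Sum>w\<in>words c.
      cnj (amplitude \<phi> (u \<oplus> a) w) * chi (dot N b (enc u)) * amplitude \<phi>' u w)"
proof -
  have ea: "enc a \<in> words N" using a enc_words by blast
  let ?s = "\<lambda>v x w. if v = x \<oplus> enc a
    then \<gamma> ^ i * (cnj (encoded \<phi> (v, w)) * chi (dot N b x) * encoded \<phi>' (x, w)) else 0"
  have "braket N c (encoded \<phi>) (apply_channel N (error_op \<gamma> N i (enc a) b) (encoded \<phi>')) =
      (\<Sum>v\<in>words N. \<Sum>w\<in>words c. \<Sum>x\<in>words N. ?s v x w)"
    unfolding braket_eq apply_channel_def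
    by (intro sum.cong refl) (auto simp: sum_distrib_left error_op_eq b intro!: sum.cong)
  also have "\<dots> = (\<Sum>x\<in>words N. \<Sum>w\<in>words c. \<Sum>v\<in>words N. ?s v x w)"
    by (simp only: sum.swap[of _ "words N" "words c"]) (rule sum.swap)
  also have "\<dots> = (\<Sum>x\<in>words N. \<Sum>w\<in>words c.
      \<gamma> ^ i * (cnj (encoded \<phi> (x \<oplus> enc a, w)) * chi (dot N b x) * encoded \<phi>' (x, w)))"
    using ea by (intro sum.cong refl) simp
  also have "\<dots> = (\<Sum>u\<in>words N. \<Sum>w\<in>words c.
      \<gamma> ^ i * (cnj (encoded \<phi> (enc u \<oplus> enc a, w)) * chi (dot N b (enc u)) * encoded \<phi>' (enc u, w)))"
    by (rule sum.reindex_bij_betw[OF enc_bij, symmetric])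
  also have "\<dots> = (\<Sum>u\<in>words N. \<Sum>w\<in>words c.
      \<gamma> ^ i * (cnj (amplitude \<phi> (u \<oplus> a) w) * chi (dot N b (enc u)) * amplitude \<phi>' u w))"
    using a by (intro sum.cong refl) (simp add: encoded_enc enc_add[symmetric])
  finally show ?thesis by (simp add: sum_distrib_left)
qed

text \<open>Every term vanishes: a shift in the second ancilla block leaves the ancilla value 0, and
  a shift in the entangled halves breaks their agreement with the receiver's word, on which no error
  acts.\<close>

lemma braket_bad_shift:
  assumes a: "a \<in> words N" and b: "b \<in> words N"
    and j: "K + h \<le> j" "j < N" "a ! j \<noteq> 0"
  shows "braket N c (encoded \<phi>) (apply_channel N (error_op \<gamma> N i (enc a) b) (encoded \<phi>')) = 0"
proof -
  have "cnj (amplitude \<phi> (u \<oplus> a) w) * x * amplitude \<phi>' u w = 0" if u: "u \<in> words N" for u w x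
  proof (rule ccontr)
    assume "\<not> ?thesis"
    then have nz: "ancilla_zero (u \<oplus> a)" "ancilla_zero u" "drop (N - c) (u \<oplus> a) = drop (N - c) u"
      by (auto simp: amplitude_def split: if_splits)
    have sum: "(u \<oplus> a) ! j = u ! j + a ! j" using u a j by simp
    show False
    proof (cases "j < K + 2 * h")
      case True
      then show False using nz sum j by (auto simp: ancilla_zero_def)
    next
      case False
      then have "N - c + (j - (N - c)) = j" using N_eq j by simp
      moreover have "N - c \<le> length (u \<oplus> a)" "N - c \<le> length u"
        using u a by (simp_all add: words_def)
      ultimately have "(u \<oplus> a) ! j = u ! j"
        using nz(3) by (metis nth_drop)
      then show False using sum j by simp
    qed
  qed
  then show ?thesis unfolding braket_error[OF a b] by (simp del: mult_eq_0_iff)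
qed

text \<open>Here the shift preserves the ancilla condition and the entangled halves, so for each
  \<open>u\<close> exactly one receiver word contributes.\<close>

lemma braket_good_shift:
  assumes a: "a \<in> words N" and b: "b \<in> words N"
    and zero: "\<And>j. K + h \<le> j \<Longrightarrow> j < N \<Longrightarrow> a ! j = 0"
  shows "braket N c (encoded \<phi>) (apply_channel N (error_op \<gamma> N i (enc a) b) (encoded \<phi>')) =
    \<gamma> ^ i * amplitude_scale\<^sup>2 * (\<Sum>u\<in>words N.
      (if ancilla_zero u then cnj (\<phi> (take K (u \<oplus> a))) * \<phi>' (take K u) else 0) * chi (dot N b (enc u)))"
proof -
  have "(\<Sum>w\<in>words c. cnj (amplitude \<phi> (u \<oplus> a) w) * chi (dot N b (enc u)) * amplitude \<phi>' u w) =
      amplitude_scale\<^sup>2 * ((if ancilla_zero u then cnj (\<phi> (take K (u \<oplus> a))) * \<phi>' (take K u) else 0)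
        * chi (dot N b (enc u)))" (is "?l = ?r")
    if u: "u \<in> words N" for u
  proof -
    have sum: "(u \<oplus> a) ! j = u ! j" if "K + h \<le> j" "j < N" for j
      using that u a zero by simp
    have anc: "ancilla_zero (u \<oplus> a) \<longleftrightarrow> ancilla_zero u"
      using sum N_eq by (auto simp: ancilla_zero_def)
    have drop: "drop (N - c) (u \<oplus> a) = drop (N - c) u"
      using u a N_eq sum by (intro nth_equalityI) (auto simp: words_def)
    have "?l = (\<Sum>w\<in>words c. if drop (N - c) u = w then ?r else 0)"
      by (intro sum.cong refl) (simp add: amplitude_def anc drop power2_eq_square)
    also have "\<dots> = ?r"
    proof -
      have "drop (N - c) u \<in> words c" using u N_eq by (simp add: words_def)
      then show ?thesis by (subst sum.delta') auto
    qed
    finally show ?thesis .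
  qed
  then show ?thesis by (simp add: braket_error a b sum_distrib_left mult.assoc)
qed

section \<open>The distance and its exactness\<close>

lemma enc_zero [simp]: "enc (zero_word N) = zero_word N"
proof -
  have z: "map ((*) 0) u = zero_word N" if "u \<in> words N" for u :: "'a list"
    using that by (auto simp: words_def map_replicate_const[symmetric] intro: nth_equalityI)
  show ?thesis using enc_scale[of "zero_word N" 0] z enc_words by auto
qed

lemma error_weight_zero_iff:
  assumes "a \<in> words N" "b \<in> words N"
  shows "error_weight N a b = 0 \<longleftrightarrow> a = zero_word N \<and> b = zero_word N"
proof
  assume "error_weight N a b = 0"
  then show "a = zero_word N \<and> b = zero_word N"
    using assms by (auto simp: error_weight_def intro!: word_eqI[where m = N])
qed (simp add: error_weight_def)

text \<open>Unless the bit flip is caught by \<open>braket_bad_shift\<close>, its low weight forces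
  it to be 0, leaving a pure phase error. Such an error cancels by translation along a word
  supported on the first ancilla block and the entangled halves, where the amplitudes weighting the
  phases are constant.\<close>

lemma braket_low_weight_error:
  assumes a: "a \<in> words N" and b: "b \<in> words N"
    and wt: "0 < error_weight N a b" "error_weight N a b < d"
  shows "braket N c (encoded \<phi>) (apply_channel N (error_op \<gamma> N i a b) (encoded \<phi>')) = 0"
proof (cases "\<exists>j. K + h \<le> j \<and> j < N \<and> dec a ! j \<noteq> 0")
  case True
  then show ?thesis using braket_bad_shift[of "dec a" b] a b by auto
next
  case False
  have "error_weight N a (zero_word N) \<le> error_weight N a b"
    by (subst (2) error_weight_def, rule error_weight_le) auto
  then have "dec a = zero_word N"
    using bit_flip_distance[of "dec a"] False a wt by auto
  then have a0: "a = zero_word N" using a enc_dec enc_zero by metis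
  then have "b \<noteq> zero_word N" using wt error_weight_zero_iff[OF a b] by auto
  then obtain w0 where w0: "w0 \<in> words N"
    and w0_zero: "\<And>j. j < N \<Longrightarrow> j < K \<or> K + h \<le> j \<and> j < K + 2 * h \<Longrightarrow> w0 ! j = 0"
    and g: "dot N b (enc w0) \<noteq> 0"
    using phase_distance[OF b] wt a0 by blast
  obtain t where t: "chi (t * dot N b (enc w0)) \<noteq> 1"
    using chi_mult_nontrivial[OF g] by blast
  define w where "w = map ((*) t) w0"
  have w: "w \<in> words N" using w0 by (simp add: w_def words_def)
  have w_zero: "w ! j = 0" if "j < N" "j < K \<or> K + h \<le> j \<and> j < K + 2 * h" for j
    using w0_zero[OF that] that w0 by (simp add: w_def words_def)
  have "(\<Sum>u\<in>words N. (if ancilla_zero u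
      then cnj (\<phi> (take K (u \<oplus> zero_word N))) * \<phi>' (take K u) else 0) * chi (dot N b (enc u))) = 0"
  proof (rule sum_chi_translation_zero[OF w _ _ t])
    fix u :: "'a list" assume u: "u \<in> words N"
    have "take K (u \<oplus> w) = take K u"
      using u w w_zero N_eq by (intro nth_equalityI) (auto simp: words_def)
    moreover have "ancilla_zero (u \<oplus> w) \<longleftrightarrow> ancilla_zero u"
      using u w w_zero N_eq by (auto simp: ancilla_zero_def)
    ultimately show "(if ancilla_zero (u \<oplus> w)
        then cnj (\<phi> (take K (u \<oplus> w \<oplus> zero_word N))) * \<phi>' (take K (u \<oplus> w)) else 0) =
      (if ancilla_zero u then cnj (\<phi> (take K (u \<oplus> zero_word N))) * \<phi>' (take K u) else 0)"
      using u w by simp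
    show "dot N b (enc (u \<oplus> w)) = dot N b (enc u) + t * dot N b (enc w0)"
    proof -
      have "enc w = map ((*) t) (enc w0)" using w0 by (simp add: w_def enc_scale)
      then have "dot N b (enc w) = t * dot N b (enc w0)"
        using w0 enc_words by (simp add: dot_scale)
      then show ?thesis using u w enc_words by (simp add: enc_add dot_add)
    qed
  qed
  then show ?thesis
    using braket_good_shift[of "zero_word N" b] b a0 by simp
qed

lemma braket_trivial_error:
  fixes \<psi> \<psi>' :: "'a state"
  shows "braket N c \<psi> (apply_channel N (error_op \<gamma> N i (zero_word N) (zero_word N)) \<psi>') =
    \<gamma> ^ i * braket N c \<psi> \<psi>'"
proof -
  have "apply_channel N (error_op \<gamma> N i (zero_word N) (zero_word N)) \<psi>' (v, w) = \<gamma> ^ i * \<psi>' (v, w)"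
    if v: "v \<in> words N" for v w
  proof -
    have "apply_channel N (error_op \<gamma> N i (zero_word N) (zero_word N)) \<psi>' (v, w) =
        (\<Sum>u\<in>words N. if v = u then \<gamma> ^ i * \<psi>' (u, w) else 0)"
      using v unfolding apply_channel_def case_prod_conv if_P[OF v]
      by (intro sum.cong refl) (simp add: error_op_eq[OF zero_word_in_words] dot_def)
    then show ?thesis using v by simp
  qed
  then show ?thesis by (simp add: braket_eq sum_distrib_left mult.left_commute)
qed

lemma has_distance_ge_encoded: "has_distance_ge \<gamma> N K c (range encoded) d"
proof -
  have "braket N c u (apply_channel N (error_op \<gamma> N i a b) v) = 0"
    if "braket N c u v = 0" "a \<in> words N" "b \<in> words N" "error_weight N a b < d"
      "u \<in> range encoded" "v \<in> range encoded" for u v i a b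
    using that braket_low_weight_error[OF that(2,3)] braket_trivial_error[of u i v]
      error_weight_zero_iff[OF that(2,3)] by (cases "error_weight N a b = 0") auto
  then show ?thesis
    unfolding has_distance_ge_def using braket_low_weight_error by auto
qed

lemma not_has_distance_ge_encoded:
  assumes "d < d'"
  shows "\<not> has_distance_ge \<gamma> N K c (range encoded) d'"
proof
  assume dist: "has_distance_ge \<gamma> N K c (range encoded) d'"
  obtain a where a: "a \<in> words N" "\<And>j. K + h \<le> j \<Longrightarrow> j < N \<Longrightarrow> a ! j = 0" "a \<noteq> zero_word N"
    and aK: "0 < K \<longrightarrow> take K a \<noteq> zero_word K" and wt: "error_weight N (enc a) (zero_word N) \<le> d"
    using low_weight by blast
  have ea: "enc a \<in> words N" using a enc_words by blast
  have "enc a \<noteq> zero_word N"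
    using a enc_zero enc_inj by (metis inj_onD zero_word_in_words)
  then have wt_pos: "1 \<le> error_weight N (enc a) (zero_word N)"
    using error_weight_zero_iff[OF ea zero_word_in_words] by linarith
  \<comment> \<open>For \<open>K > 0\<close> these are two orthogonal basis states that the logical
    shift \<open>a\<close> maps onto each other; for \<open>K = 0\<close> both are the same code
    state, fixed by that shift. No phases occur, so the overlap is a positive count times a nonzero
    square.\<close>
  define \<phi> where "\<phi> x = (if K = 0 \<or> x = take K a then 1 else 0 :: complex)" for x
  define \<phi>' where "\<phi>' x = (if K = 0 \<or> x = zero_word K then 1 else 0 :: complex)" for x :: "'a list"
  let ?b = "braket N c (encoded \<phi>) (apply_channel N (error_op \<gamma> N 0 (enc a) (zero_word N)) (encoded \<phi>'))"
  have take: "take K (u \<oplus> a) = take K a" if "u \<in> words N" "take K u = zero_word K" for u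
  proof (rule nth_equalityI)
    fix j assume j: "j < length (take K (u \<oplus> a))"
    then have "u ! j = 0" using that by (metis length_take min_less_iff_conj nth_replicate nth_take)
    then show "take K (u \<oplus> a) ! j = take K a ! j" using j that a by (simp add: words_def)
  qed (use that a in \<open>simp add: words_def\<close>)
  let ?A = "{u \<in> words N. ancilla_zero u \<and> take K u = zero_word K}"
  have "?b = amplitude_scale\<^sup>2 * (\<Sum>u\<in>words N. if u \<in> ?A then 1 else (0::complex))"
  proof -
    have "?b = \<gamma> ^ 0 * amplitude_scale\<^sup>2 * (\<Sum>u\<in>words N.
        (if ancilla_zero u then cnj (\<phi> (take K (u \<oplus> a))) * \<phi>' (take K u) else 0) *
        chi (dot N (zero_word N) (enc u)))"
      by (rule braket_good_shift) (use a in auto)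
    also have "(\<Sum>u\<in>words N.
        (if ancilla_zero u then cnj (\<phi> (take K (u \<oplus> a))) * \<phi>' (take K u) else 0) *
        chi (dot N (zero_word N) (enc u))) = (\<Sum>u\<in>words N. if u \<in> ?A then 1 else 0)"
      by (intro sum.cong refl) (auto simp: dot_def \<phi>_def \<phi>'_def take)
    finally show ?thesis by simp
  qed
  also have "(\<Sum>u\<in>words N. if u \<in> ?A then 1 else (0::complex)) = (of_nat (card ?A) :: complex)"
    by (simp flip: sum.inter_filter)
  finally have "?b = complex_of_real (amplitude_scale\<^sup>2) * of_nat (card ?A)" .
  moreover have "zero_word N \<in> ?A" using N_eq by (simp add: ancilla_zero_def)
  moreover have "finite ?A" by simp
  ultimately have nz: "?b \<noteq> 0" using amplitude_scale_nonzero by (metis (lifting)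
    card_0_eq empty_iff mult_eq_0_iff of_nat_eq_0_iff of_real_eq_0_iff zero_eq_power2)
  show False
  proof (cases "K = 0")
    case True
    then have "\<phi>' = \<phi>" by (simp add: \<phi>_def \<phi>'_def fun_eq_iff)
    then have "?b = 0"
      using dist True wt wt_pos assms ea by (auto simp: has_distance_ge_def)
    then show False using nz by simp
  next
    case False
    have "braket N c (encoded \<phi>) (encoded \<phi>') =
        braket N c (encoded \<phi>) (apply_channel N (error_op \<gamma> N 0 (enc (zero_word N)) (zero_word N)) (encoded \<phi>'))"
      by (simp add: braket_trivial_error)
    also have "\<dots> = 0"
    proof -
      have "cnj (\<phi> (take K (u \<oplus> zero_word N))) * \<phi>' (take K u) = 0" if "u \<in> words N" for u
        using that False aK by (auto simp: \<phi>_def \<phi>'_def)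
      then show ?thesis
        by (subst braket_good_shift) (auto intro!: sum.neutral)
    qed
    finally have "?b = 0"
      using dist False wt assms ea by (auto simp: has_distance_ge_def)
    then show False using nz by simp
  qed
qed

theorem css_EAQECC: "EAQECC \<gamma> N K d c (range encoded)"
proof -
  have "K + c \<le> N" using N_eq by simp
  moreover have "range encoded = encoded_space N K c encoder"
    by (simp add: encoded_space_def encoded_def[abs_def])
  ultimately show ?thesis
    unfolding EAQECC_def minimum_distance_def
    using has_distance_ge_encoded not_has_distance_ge_encoded unitary_encoder by blast
qed

end

section \<open>Codes from polynomials\<close>

definition block_poly :: "nat \<Rightarrow> nat \<Rightarrow> 'a::comm_ring_1 list \<Rightarrow> 'a poly" where
  "block_poly i m u = Poly (take m (drop i u))"

lemma coeff_block_poly: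
  assumes "i + m \<le> length u"
  shows "coeff (block_poly i m u) j = (if j < m then u ! (i + j) else 0)"
  using assms by (auto simp: block_poly_def nth_default_def)

lemma block_poly_add:
  assumes "u \<in> words N" "v \<in> words N" "i + m \<le> N"
  shows "block_poly i m (u \<oplus> v) = block_poly i m u + block_poly i m v"
  using assms by (intro poly_eqI) (simp add: coeff_block_poly length_in_words)

lemma block_poly_scale:
  assumes "u \<in> words N" "i + m \<le> N"
  shows "block_poly i m (map ((*) a) u) = smult a (block_poly i m u)"
  using assms by (intro poly_eqI) (simp add: coeff_block_poly length_in_words)

lemma block_poly_eq_zero:
  assumes "\<And>j. i \<le> j \<Longrightarrow> j < i + m \<Longrightarrow> u ! j = 0" "i + m \<le> length u"
  shows "block_poly i m u = 0"
  using assms by (intro poly_eqI) (simp add: coeff_block_poly)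

lemma block_poly_eq_zeroD:
  assumes "block_poly i m u = 0" "i + m \<le> length u" "i \<le> j" "j < i + m"
  shows "u ! j = 0"
proof -
  have "j - i < m" using assms by linarith
  then show ?thesis using coeff_block_poly[OF assms(2), of "j - i"] assms by simp
qed

text \<open>
  Putting the ancilla block below the information block makes the words without information
  the polynomials of degree below \<open>h\<close>.
\<close>

definition info_poly :: "nat \<Rightarrow> nat \<Rightarrow> 'a::comm_ring_1 list \<Rightarrow> 'a poly" where
  "info_poly h K u = block_poly K h u + monom 1 h * block_poly 0 K u"

lemma coeff_info_poly:
  assumes "K + h \<le> length u"
  shows "coeff (info_poly h K u) j =
    (if j < h then u ! (K + j) else if j < K + h then u ! (j - h) else 0)"
  using assms by (auto simp: info_poly_def coeff_block_poly coeff_monom_mult)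

lemma info_poly_add:
  assumes "u \<in> words N" "v \<in> words N" "K + h \<le> N"
  shows "info_poly h K (u \<oplus> v) = info_poly h K u + info_poly h K v"
  using assms by (simp add: info_poly_def block_poly_add[of u N v] distrib_left)

lemma info_poly_scale:
  assumes "u \<in> words N" "K + h \<le> N"
  shows "info_poly h K (map ((*) a) u) = smult a (info_poly h K u)"
  using assms by (simp add: info_poly_def block_poly_scale[of u N] smult_add_right)

lemma info_poly_eq_zeroD:
  assumes "info_poly h K u = 0" "K + h \<le> length u" "j < K + h"
  shows "u ! j = 0"
proof (cases "j < K")
  case True
  then show ?thesis using coeff_info_poly[OF assms(2), of "h + j"] assms by auto
next
  case False
  then have "j - K < h" using assms by linarith
  then show ?thesis using coeff_info_poly[OF assms(2), of "j - K"] assms False by simp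
qed

lemma degree_info_poly:
  assumes "K + h \<le> length u" "0 < K + h"
  shows "degree (info_poly h K u) < K + h"
  using assms by (intro degree_lessI) (auto simp: coeff_info_poly)

lemma info_poly_surj:
  fixes F :: "'a::comm_ring_1 poly"
  assumes "degree F < K + h" "K + h \<le> N"
  obtains u where "u \<in> words N" "info_poly h K u = F" "\<And>j. K + h \<le> j \<Longrightarrow> j < N \<Longrightarrow> u ! j = 0"
proof
  let ?u = "map (\<lambda>j. if j < K then coeff F (h + j) else if j < K + h then coeff F (j - K) else 0) [0..<N]"
  show "?u \<in> words N" by (simp add: words_def)
  show "info_poly h K ?u = F"
    using assms by (intro poly_eqI) (auto simp: coeff_info_poly coeff_eq_0)
qed auto

lemma inj_on_words_if_kernel_trivial:
  fixes enc :: "'a::comm_ring_1 list \<Rightarrow> 'a list"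
  assumes words: "\<And>u. u \<in> words N \<Longrightarrow> enc u \<in> words N"
    and add: "\<And>u v. u \<in> words N \<Longrightarrow> v \<in> words N \<Longrightarrow> enc (u \<oplus> v) = enc u \<oplus> enc v"
    and scale: "\<And>a u. u \<in> words N \<Longrightarrow> enc (map ((*) a) u) = map ((*) a) (enc u)"
    and kernel: "\<And>u. u \<in> words N \<Longrightarrow> enc u = zero_word N \<Longrightarrow> u = zero_word N"
  shows "inj_on enc (words N)"
proof (rule inj_onI)
  fix u v assume u: "u \<in> words N" and v: "v \<in> words N" and eq: "enc u = enc v"
  \<comment> \<open>The difference of \<open>u\<close> and \<open>v\<close> is formed as a sum with
    a multiple, so that additivity and scaling of \<open>enc\<close> apply.\<close>
  define v' where "v' = map ((*) (-1)) v"
  have v': "v' \<in> words N" using v by (simp add: v'_def words_def)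
  have ev: "enc v \<in> words N" using words v by blast
  have "enc (u \<oplus> v') = enc v \<oplus> map ((*) (-1)) (enc v)"
    unfolding add[OF u v'] unfolding v'_def scale[OF v] eq ..
  also have "\<dots> = zero_word N"
    using ev by (intro nth_equalityI) (simp_all add: length_in_words)
  finally have "enc (u \<oplus> v') = zero_word N" .
  then have "u \<oplus> v' = zero_word N" by (rule kernel[OF word_add_in_words[OF u v']])
  then have "u ! j + v' ! j = 0" if "j < N" for j
    using nth_word_add[OF u v' that] that by simp
  then show "u = v"
    using u v by (intro word_eqI[of _ N]) (auto simp: v'_def length_in_words)
qed

lemma poly_eq_zero_if_many_roots:
  fixes f :: "'a::idom poly"
  assumes "inj_on pts I" "finite I" "\<And>i. i \<in> I \<Longrightarrow> poly f (pts i) = 0" "degree f < card I"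
  shows "f = 0"
  by (rule poly_eqI_degree[where A = "pts ` I"]) (use assms in \<open>auto simp: card_image\<close>)

lemma degree_prod_linear:
  fixes pts :: "nat \<Rightarrow> 'a::idom"
  shows "degree (\<Prod>i\<in>I. [:- pts i, 1:]) = card I"
  by (subst degree_prod_eq_sum_degree) auto

lemma lead_coeff_prod_linear:
  fixes pts :: "nat \<Rightarrow> 'a::idom"
  shows "lead_coeff (\<Prod>i\<in>I. [:- pts i, 1:]) = 1"
  by (simp add: lead_coeff_prod)

text \<open>\<open>x ^ t - x ^ (t - 1)\<close> vanishes at both 0 and 1, so on a finite field it misses some value.\<close>

lemma root_free_poly:
  fixes A :: "'a::{finite,field} set"
  assumes "A \<noteq> UNIV \<or> 2 \<le> t"
  shows "\<exists>s. degree s = t \<and> lead_coeff s = 1 \<and> (\<forall>x\<in>A. poly s x \<noteq> 0)"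
proof (cases "A = UNIV")
  case False
  then obtain \<beta> where "\<beta> \<notin> A" by blast
  have "lead_coeff ([:- \<beta>, 1:] ^ t) = 1"
    by (subst lead_coeff_power) simp
  then show ?thesis
    using \<open>\<beta> \<notin> A\<close> by (intro exI[of _ "[:- \<beta>, 1:] ^ t"]) (auto simp: degree_power_eq)
next
  case True
  then have t: "2 \<le> t" using assms by simp
  let ?f = "\<lambda>x::'a. x ^ t - x ^ (t - 1)"
  have "?f 0 = ?f 1" using t by (simp add: power_0_left)
  then have "\<not> inj ?f" using injD[of ?f 0 1] by auto
  then have "\<not> surj ?f" using finite_UNIV_surj_inj[of ?f] finite_class.finite_UNIV by blast
  then obtain y where "y \<notin> range ?f" by blast
  then have y: "y \<noteq> ?f x" for x by blast
  define s where "s = monom 1 t - monom 1 (t - 1) - [:y:]"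
  have coeff_t: "coeff s t = 1"
    using t by (cases t) (auto simp: s_def coeff_monom)
  have "coeff s j = 0" if "j > t" for j
    using t that by (cases j) (auto simp: s_def coeff_monom)
  then have "degree s = t"
    using coeff_t by (intro antisym degree_le le_degree) auto
  moreover have "poly s x \<noteq> 0" for x
    using y[of x] by (auto simp: s_def poly_monom)
  ultimately show ?thesis using coeff_t by auto
qed

text \<open>The remainder is too short to cancel the leading term of \<open>(g div s) * s\<close>,
  which therefore survives in \<open>g\<close>. The bound is on coefficients rather than degrees so
  that \<open>h = 0\<close> forces the quotient to be 0.\<close>

lemma coeff_div_eq_0:
  fixes g s :: "'a::field poly"
  assumes "s \<noteq> 0" "\<And>i. degree s + h \<le> i \<Longrightarrow> coeff g i = 0" "h \<le> j"
  shows "coeff (g div s) j = 0"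
proof (rule ccontr)
  assume nz: "coeff (g div s) j \<noteq> 0"
  then have q: "g div s \<noteq> 0" "j \<le> degree (g div s)" by (auto intro: le_degree)
  let ?d = "degree s + degree (g div s)"
  have "coeff (g mod s) ?d = 0"
    using degree_mod_less[OF assms(1), of g] by (auto intro: coeff_eq_0)
  then have "coeff g ?d = coeff (g div s * s) ?d"
    by (metis add.right_neutral coeff_add div_mult_mod_eq)
  also have "\<dots> = lead_coeff (g div s) * lead_coeff s"
    by (metis coeff_mult_degree_sum add.commute)
  also have "\<dots> \<noteq> 0" using q assms(1) by simp
  finally show False using assms(2)[of ?d] assms(3) q by simp
qed

lemma coeff_mod_eq_0:
  fixes g s :: "'a::field poly"
  assumes "s \<noteq> 0" "degree s \<le> j"
  shows "coeff (g mod s) j = 0"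
  using degree_mod_less[OF assms(1), of g] assms(2) by (auto intro: coeff_eq_0)

text \<open>Vanishing on the support except at \<open>i0\<close> isolates one term. A phase error of
  weight w is thus detected by a polynomial of degree w - 1, which is the MDS property of the dual
  code.\<close>

lemma annihilator_of_support:
  fixes pts :: "nat \<Rightarrow> 'a::idom"
  assumes "inj_on pts {..<m}" "i0 < m" "b ! i0 \<noteq> 0"
  defines "S \<equiv> {i. i < m \<and> b ! i \<noteq> 0}"
  defines "g \<equiv> \<Prod>i\<in>S - {i0}. [:- pts i, 1:]"
  shows "(\<Sum>i<m. b ! i * poly g (pts i)) \<noteq> 0"
proof -
  have fin: "finite S" by (simp add: S_def)
  have "poly g (pts i0) \<noteq> 0"
    using assms fin by (auto simp: g_def poly_prod S_def inj_on_def)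
  moreover have "b ! i * poly g (pts i) = 0" if "i < m" "i \<noteq> i0" for i
  proof (cases "b ! i = 0")
    case False
    then have "i \<in> S - {i0}" using that by (simp add: S_def)
    then have "poly g (pts i) = 0" using fin by (auto simp: g_def poly_prod prod_zero_iff)
    then show ?thesis by simp
  qed simp
  then have "(\<Sum>i<m. b ! i * poly g (pts i)) = (\<Sum>i\<in>{i0}. b ! i * poly g (pts i))"
    using assms(2) by (intro sum.mono_neutral_right) auto
  ultimately show ?thesis using assms(3) by simp
qed

section \<open>Encoders from evaluation codes\<close>

context trace_character
begin

text \<open>
  With \<open>s\<close> of degree \<open>c = N - k - h\<close>, the entangled halves carry the degrees below \<open>c\<close>, the
  multiples of \<open>s\<close> carry the next \<open>k\<close> degrees and the second ancilla block the top \<open>h\<close> degrees.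
\<close>

lemma affine_EAQECC:
  fixes pts :: "nat \<Rightarrow> 'a" and s :: "'a poly"
  assumes pts: "inj_on pts {..<N}"
    and k: "1 \<le> k" "h \<le> k" "k + h \<le> N"
    and s_degree: "degree s = N - k - h"
    and s_roots: "\<And>i. i < N \<Longrightarrow> poly s (pts i) \<noteq> 0"
    and s_nonzero: "s \<noteq> 0"
  shows "\<exists>Q :: 'a state set. EAQECC \<gamma> N (k - h) (N + 1 - k) (N - k - h) Q"
proof -
  define K where "K = k - h"
  define c where "c = N - k - h"
  have dims: "N = K + 2 * h + c" "k = K + h" using k by (simp_all add: K_def c_def)
  have le: "K + h \<le> N" "K + 2 * h + c \<le> N" "K + h + h \<le> N" using dims by simp_all
  define B where "B u = s * info_poly h K u + block_poly (K + 2 * h) c u +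
    monom 1 (N - h) * block_poly (K + h) h u" for u :: "'a list"
  define enc where "enc u = map (\<lambda>i. poly (B u) (pts i)) [0..<N]" for u :: "'a list"
  have enc_nth: "enc u ! i = poly (B u) (pts i)" if "i < N" for u i
    using that by (simp add: enc_def)
  have enc_words: "enc u \<in> words N" for u by (simp add: enc_def words_def)
  have B_add: "B (u \<oplus> v) = B u + B v" if "u \<in> words N" "v \<in> words N" for u v
    using that le
    by (simp add: B_def info_poly_add[of u N v] block_poly_add[of u N v] algebra_simps)
  have B_scale: "B (map ((*) a) u) = smult a (B u)" if "u \<in> words N" for a u
    using that le
    by (simp add: B_def info_poly_scale[of u N] block_poly_scale[of u N] smult_add_right)
  have enc_add: "enc (u \<oplus> v) = enc u \<oplus> enc v" if "u \<in> words N" "v \<in> words N" for u v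
    by (rule word_eqI[of _ N]) (simp_all add: enc_words enc_nth B_add that nth_word_add[of _ N])
  have enc_scale: "enc (map ((*) a) u) = map ((*) a) (enc u)" if "u \<in> words N" for a u
    unfolding enc_def by (simp add: B_scale[OF that])
  have s_info: "degree (s * info_poly h K u) < N - h" if "u \<in> words N" for u
  proof -
    have "degree (info_poly h K u) < K + h"
      using that le k dims by (intro degree_info_poly) (auto simp: length_in_words)
    then show ?thesis
      using degree_mult_le[of s "info_poly h K u"] s_degree dims by simp
  qed
  have kernel: "u = zero_word N" if u: "u \<in> words N" and "enc u = zero_word N" for u
  proof -
    have len: "length u = N" using u by (simp add: words_def)
    have roots: "poly (B u) (pts i) = 0" if "i < N" for i
      using enc_nth[OF that, of u] \<open>enc u = zero_word N\<close> that by simp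
    have coeff_B: "coeff (B u) j = coeff (s * info_poly h K u) j +
        coeff (block_poly (K + 2 * h) c u) j +
        (if j < N - h then 0 else coeff (block_poly (K + h) h u) (j - (N - h)))" for j
      by (simp add: B_def coeff_monom_mult)
    have "degree (B u) < N"
    proof (rule degree_lessI)
      show "\<forall>j\<ge>N. coeff (B u) j = 0"
        using s_info[OF u] len le dims
        by (auto simp: coeff_B coeff_block_poly coeff_eq_0)
    qed (use k in simp)
    then have B0: "B u = 0"
      using poly_eq_zero_if_many_roots[OF pts _ roots] by simp
    have Z: "block_poly (K + h) h u = 0"
    proof (rule poly_eqI)
      fix j
      have "coeff (B u) (N - h + j) = 0" using B0 by simp
      moreover have "coeff (s * info_poly h K u) (N - h + j) = 0"
        using s_info[OF u] by (intro coeff_eq_0) simp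
      moreover have "coeff (block_poly (K + 2 * h) c u) (N - h + j) = 0"
        using len le dims by (simp add: coeff_block_poly)
      ultimately show "coeff (block_poly (K + h) h u) j = coeff 0 j"
        by (simp add: coeff_B)
    qed
    \<comment> \<open>A nonzero multiple of \<open>s\<close> has degree at least \<open>c\<close>,
      out of reach of the block of degrees below \<open>c\<close>.\<close>
    have f: "info_poly h K u = 0"
    proof (rule ccontr)
      assume nz: "info_poly h K u \<noteq> 0"
      let ?d = "degree (s * info_poly h K u)"
      have "?d \<ge> c" using nz s_nonzero s_degree by (simp add: degree_mult_eq c_def)
      then have "coeff (block_poly (K + 2 * h) c u) ?d = 0"
        using len le by (simp add: coeff_block_poly)
      then have "coeff (s * info_poly h K u) ?d = 0"
        using B0 Z by (simp add: B_def add_eq_0_iff)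
      then show False using nz s_nonzero by (simp only: leading_coeff_0_iff) simp
    qed
    have S: "block_poly (K + 2 * h) c u = 0" using B0 Z f by (simp add: B_def)
    show ?thesis
    proof (rule word_eqI[OF u zero_word_in_words])
      fix j assume "j < N"
      then consider "j < K + h" | "K + h \<le> j" "j < K + h + h"
        | "K + 2 * h \<le> j" "j < K + 2 * h + c" using dims by linarith
      then have "u ! j = 0"
        using info_poly_eq_zeroD[OF f] block_poly_eq_zeroD[OF Z] block_poly_eq_zeroD[OF S] len le
        by cases auto
      then show "u ! j = zero_word N ! j" using \<open>j < N\<close> by simp
    qed
  qed
  have B_info: "B u = s * info_poly h K u"
    if "u \<in> words N" "\<And>j. K + h \<le> j \<Longrightarrow> j < N \<Longrightarrow> u ! j = 0" for u
  proof -
    have "block_poly (K + 2 * h) c u = 0" "block_poly (K + h) h u = 0"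
      using that le by (auto intro!: block_poly_eq_zero simp: length_in_words)
    then show ?thesis by (simp add: B_def)
  qed
  have "css_encoding p e \<gamma> N K h c (N + 1 - k) enc"
  proof unfold_locales
    show "N = K + 2 * h + c" by (rule dims)
    show "inj_on enc (words N)"
      using enc_words enc_add enc_scale kernel by (rule inj_on_words_if_kernel_trivial)
  next
    fix u :: "'a list"
    assume u: "u \<in> words N" and u0: "\<And>j. K + h \<le> j \<Longrightarrow> j < N \<Longrightarrow> u ! j = 0"
      and wt: "error_weight N (enc u) (zero_word N) < N + 1 - k"
    let ?Z = "{i. i < N \<and> enc u ! i = 0}"
    have "error_weight N (enc u) (zero_word N) = card ({..<N} - ?Z)"
      unfolding error_weight_def by (rule arg_cong[where f = card]) auto
    also have "\<dots> = N - card ?Z"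
      by (subst card_Diff_subset) auto
    \<comment> \<open>There are at least \<open>k\<close> zeros, while the information polynomial
      has degree below \<open>k\<close> and \<open>s\<close> contributes none.\<close>
    finally have Z: "k \<le> card ?Z" using wt k by linarith
    have "info_poly h K u = 0"
    proof (rule poly_eq_zero_if_many_roots)
      show "inj_on pts ?Z" using pts by (rule inj_on_subset) auto
      show "poly (info_poly h K u) (pts i) = 0" if "i \<in> ?Z" for i
        using that s_roots[of i] enc_nth[of i u] B_info[OF u u0] by auto
      show "degree (info_poly h K u) < card ?Z"
      proof -
        have "degree (info_poly h K u) < K + h"
          using u le k dims by (intro degree_info_poly) (auto simp: length_in_words)
        then show ?thesis using Z dims by linarith
      qed
    qed simp
    then have "enc u = zero_word N"
      by (intro word_eqI[of _ N]) (simp_all add: enc_words enc_nth B_info[OF u u0])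
    then show "u = zero_word N" using kernel u by blast
  next
    fix b :: "'a list"
    assume b: "b \<in> words N" "b \<noteq> zero_word N"
      and wt: "error_weight N (zero_word N) b < N + 1 - k"
    obtain i0 where i0: "i0 < N" "b ! i0 \<noteq> 0"
      using word_eqI[OF b(1) zero_word_in_words] b(2) by auto
    let ?S = "{i. i < N \<and> b ! i \<noteq> 0}"
    let ?g = "\<Prod>i\<in>?S - {i0}. [:- pts i, 1:]"
    have "error_weight N (zero_word N) b = card ?S"
      unfolding error_weight_def by (rule arg_cong[where f = card]) auto
    moreover have "card (?S - {i0}) < card ?S"
      using i0 by (intro psubset_card_mono) auto
    ultimately have g_degree: "degree ?g < N - k"
      using wt unfolding degree_prod_linear by linarith
    \<comment> \<open>Since \<open>N - k = h + c\<close>, division by \<open>s\<close> splits the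
      detecting polynomial into a quotient filling the first ancilla block and a remainder filling
      the entangled halves, as the phase condition demands.\<close>
    define q r where "q = ?g div s" and "r = ?g mod s"
    have r: "coeff r j = 0" if "c \<le> j" for j
      unfolding r_def using that s_nonzero s_degree by (intro coeff_mod_eq_0) (simp_all add: c_def)
    have q: "coeff q j = 0" if "h \<le> j" for j
      unfolding q_def using that s_nonzero s_degree g_degree dims
      by (intro coeff_div_eq_0[where h = h]) (auto intro: coeff_eq_0)
    let ?u = "map (\<lambda>j. if K \<le> j \<and> j < K + h then coeff q (j - K)
      else if K + 2 * h \<le> j then coeff r (j - (K + 2 * h)) else 0) [0..<N]"
    have u: "?u \<in> words N" by (simp add: words_def)
    have "info_poly h K ?u = q"
      using le q by (intro poly_eqI) (auto simp: coeff_info_poly)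
    moreover have "block_poly (K + 2 * h) c ?u = r"
      using le r by (intro poly_eqI) (auto simp: coeff_block_poly)
    moreover have "block_poly (K + h) h ?u = 0"
      using le by (intro block_poly_eq_zero) auto
    ultimately have "B ?u = ?g" by (simp add: B_def q_def r_def)
    then have "dot N b (enc ?u) = (\<Sum>i<N. b ! i * poly ?g (pts i))"
      unfolding dot_def by (intro sum.cong refl) (simp add: enc_nth)
    then have "dot N b (enc ?u) \<noteq> 0"
      using annihilator_of_support[OF pts, of i0 b] i0 by simp
    moreover have "\<forall>j<N. j < K \<or> K + h \<le> j \<and> j < K + 2 * h \<longrightarrow> ?u ! j = 0" by auto
    ultimately show "\<exists>u\<in>words N. (\<forall>j<N. j < K \<or> K + h \<le> j \<and> j < K + 2 * h \<longrightarrow> u ! j = 0) \<and>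
        dot N b (enc u) \<noteq> 0"
      using u by blast
  next
    \<comment> \<open>Vanishing at \<open>k - 1\<close> points gives weight at most
      \<open>N + 1 - k\<close>. Its leading coefficient sits in the last information coordinate when
      \<open>K > 0\<close>, so the resulting bit flip is a nontrivial logical operator.\<close>
    let ?F = "\<Prod>i\<in>{..<k - 1}. [:- pts i, 1:]"
    have F: "degree ?F = k - 1" "coeff ?F (k - 1) = 1"
      using lead_coeff_prod_linear[of pts "{..<k - 1}"] by (simp_all add: degree_prod_linear)
    have "degree ?F < K + h" unfolding F(1) using k dims by linarith
    from info_poly_surj[OF this le(1)]
    obtain u where u: "u \<in> words N" "info_poly h K u = ?F"
      and u0: "\<And>j. K + h \<le> j \<Longrightarrow> j < N \<Longrightarrow> u ! j = 0"
      by blast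
    have last: "(if k - 1 < h then u ! (K + (k - 1)) else u ! (k - 1 - h)) = 1"
    proof -
      have "k - 1 < K + h" using dims k by linarith
      then show ?thesis
        using coeff_info_poly[of K h u "k - 1"] u F le(1)
        by (simp add: length_in_words split: if_splits)
    qed
    have "u \<noteq> zero_word N"
      using last le dims k by (auto split: if_splits)
    moreover have "take K u \<noteq> zero_word K" if "0 < K"
    proof
      assume z: "take K u = zero_word K"
      have "k - 1 - h < K" "\<not> k - 1 < h" using that dims by auto
      then have "take K u ! (k - 1 - h) = 1" using last by simp
      then show False using z \<open>k - 1 - h < K\<close> by simp
    qed
    moreover have "error_weight N (enc u) (zero_word N) \<le> card {k - 1..<N}"
    proof (rule error_weight_le)
      have "enc u ! i = 0" if "i < k - 1" for i
      proof -
        have "poly ?F (pts i) = 0" using that by (auto simp: poly_prod intro!: prod_zero)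
        moreover have "i < N" using that k by linarith
        ultimately show ?thesis by (simp add: enc_nth B_info[OF u(1) u0] u(2))
      qed
      then show "{j. j < N \<and> (enc u ! j, zero_word N ! j) \<noteq> (0, 0)} \<subseteq> {k - 1..<N}"
        by (auto simp: not_less[symmetric])
    qed simp
    ultimately show "\<exists>u\<in>words N. (\<forall>j. K + h \<le> j \<and> j < N \<longrightarrow> u ! j = 0) \<and> u \<noteq> zero_word N \<and>
      (0 < K \<longrightarrow> take K u \<noteq> zero_word K) \<and> error_weight N (enc u) (zero_word N) \<le> N + 1 - k"
      using u u0 k by (intro bexI[of _ u]) auto
  qed (use enc_words enc_add enc_scale in auto)
  from css_encoding.css_EAQECC[OF this] show ?thesis
    by (auto simp: K_def c_def)
qed

text \<open>
  The point at infinity reads off a top coefficient: \<open>k - 1\<close>, scaled by \<open>\<delta>\<close>, for the bit flip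
  code, and \<open>M - k\<close> for the code of the phase errors, whose polynomial of degree \<open>M - k\<close> is the
  last entangled half. The choice \<open>\<delta> \<noteq> 1\<close> keeps the two codes apart when \<open>h = k - 1\<close>.
\<close>

lemma projective_EAQECC:
  fixes pts :: "nat \<Rightarrow> 'a" and s :: "'a poly" and \<delta> :: 'a
  assumes pts: "inj_on pts {..<M}"
    and k: "h < k" "k + h \<le> M"
    and s_degree: "degree s = M - k - h"
    and s_monic: "lead_coeff s = 1"
    and s_roots: "\<And>i. i < M \<Longrightarrow> poly s (pts i) \<noteq> 0"
    and \<delta>: "\<delta> \<noteq> 0" "\<delta> \<noteq> 1"
  shows "\<exists>Q :: 'a state set. EAQECC \<gamma> (M + 1) (k - h) (M + 2 - k) (M + 1 - k - h) Q"
proof -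
  define K where "K = k - h"
  define t where "t = M - k - h"
  define N where "N = M + 1"
  have dims: "M = K + 2 * h + t" "k = K + h" "0 < K" using k by (simp_all add: K_def t_def)
  have le: "K + h \<le> N" "K + 2 * h + t \<le> N" "K + h + h \<le> N" "M < N"
    using dims by (simp_all add: N_def)
  have s_nonzero: "s \<noteq> 0" using s_monic by auto
  define B where "B u = s * info_poly h K u + block_poly (K + 2 * h) t u +
    monom (u ! M) (M - k) + monom 1 (M - h) * block_poly (K + h) h u" for u :: "'a list"
  define E where "E u = \<delta> * u ! (K - 1) + u ! M" for u :: "'a list"
  define enc where "enc u = map (\<lambda>i. if i < M then poly (B u) (pts i) else E u) [0..<N]" for u :: "'a list"
  have enc_nth: "enc u ! i = (if i < M then poly (B u) (pts i) else E u)" if "i < N" for u i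
    using that by (simp add: enc_def)
  have enc_words: "enc u \<in> words N" for u by (simp add: enc_def words_def)
  have lin_nth: "K - 1 < N" "M < N" using le dims by simp_all
  have B_add: "B (u \<oplus> v) = B u + B v" and E_add: "E (u \<oplus> v) = E u + E v"
    if "u \<in> words N" "v \<in> words N" for u v
    using that le lin_nth
    by (simp_all add: B_def E_def info_poly_add[of u N v] block_poly_add[of u N v]
      nth_word_add[of u N v] algebra_simps flip: add_monom)
  have B_scale: "B (map ((*) a) u) = smult a (B u)" and E_scale: "E (map ((*) a) u) = a * E u"
    if "u \<in> words N" for a u
    using that le lin_nth
    by (simp_all add: B_def E_def info_poly_scale[of u N] block_poly_scale[of u N] smult_add_right
      smult_monom length_in_words algebra_simps)
  have enc_add: "enc (u \<oplus> v) = enc u \<oplus> enc v" if "u \<in> words N" "v \<in> words N" for u v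
    by (rule word_eqI[of _ N])
      (simp_all add: enc_words enc_nth B_add E_add that nth_word_add[of _ N])
  have enc_scale: "enc (map ((*) a) u) = map ((*) a) (enc u)" if "u \<in> words N" for a u
    unfolding enc_def by (simp add: B_scale[OF that] E_scale[OF that])
  have f_degree: "degree (info_poly h K u) < k" if "u \<in> words N" for u
    using that le dims degree_info_poly[of K h u] by (simp add: length_in_words)
  have s_info: "degree (s * info_poly h K u) < M - h" if "u \<in> words N" for u
    using degree_mult_le[of s "info_poly h K u"] f_degree[OF that] s_degree dims by simp
  have f_top: "coeff (info_poly h K u) (k - 1) = u ! (K - 1)" if "u \<in> words N" for u
  proof -
    have "\<not> k - 1 < h" "k - 1 < K + h" "k - 1 - h = K - 1" using dims by linarith+
    then show ?thesis using that le by (simp add: coeff_info_poly length_in_words)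
  qed
  have kernel: "u = zero_word N" if u: "u \<in> words N" and enc0: "enc u = zero_word N" for u
  proof -
    define f where "f = info_poly h K u"
    have len: "length u = N" using u by (simp add: words_def)
    have roots: "poly (B u) (pts i) = 0" if "i < M" for i
      using enc_nth[of i u] enc0 that le(4) by simp
    have E0: "E u = 0"
      using enc_nth[of M u] enc0 le(4) by simp
    have coeff_B: "coeff (B u) j = coeff (s * f) j +
        coeff (block_poly (K + 2 * h) t u) j + (if j = M - k then u ! M else 0) +
        (if j < M - h then 0 else coeff (block_poly (K + h) h u) (j - (M - h)))" for j
      by (simp add: B_def f_def coeff_monom_mult)
    have block_S: "coeff (block_poly (K + 2 * h) t u) j = 0" if "t \<le> j" for j
      using that len le by (simp add: coeff_block_poly)
    have "degree (B u) < M"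
    proof (rule degree_lessI)
      show "\<forall>j\<ge>M. coeff (B u) j = 0"
        using s_info[OF u] len le dims block_S
        by (auto simp: coeff_B f_def coeff_block_poly coeff_eq_0)
    qed (use dims in simp)
    then have B0: "B u = 0"
      using poly_eq_zero_if_many_roots[OF pts _ roots] by simp
    have Z: "block_poly (K + h) h u = 0"
    proof (rule poly_eqI)
      fix j
      have "coeff (B u) (M - h + j) = 0" using B0 by simp
      moreover have "coeff (s * f) (M - h + j) = 0"
        using s_info[OF u] unfolding f_def by (intro coeff_eq_0) simp
      moreover have "coeff (block_poly (K + 2 * h) t u) (M - h + j) = 0"
        using dims by (intro block_S) simp
      moreover have "M - h + j \<noteq> M - k" using dims by simp
      ultimately show "coeff (block_poly (K + h) h u) j = coeff 0 j"
        by (simp add: coeff_B)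
    qed
    have sf: "coeff (s * f) j = - (if j = M - k then u ! M else 0)" if "t \<le> j" for j
    proof -
      have "coeff (B u) j = 0" using B0 by simp
      then show ?thesis unfolding coeff_B using block_S[OF that] Z
        by (simp add: eq_neg_iff_add_eq_0 split: if_splits)
    qed
    have sf_lead: "coeff (s * f) (t + degree f) = lead_coeff f"
      using coeff_mult_degree_sum[of s f] s_monic s_degree by (simp add: t_def)
    have Mk: "M - k = t + h" using dims by simp
    \<comment> \<open>Otherwise \<open>s * f\<close> must cancel the monomial of degree
      \<open>M - k = t + h\<close>, so \<open>f\<close> has degree \<open>h\<close> and leading
      coefficient \<open>- u ! M\<close>. If \<open>h < k - 1\<close>, the point at infinity sees
      only \<open>u ! M\<close>; if \<open>h = k - 1\<close>, it sees
      \<open>(1 - \<delta>) * u ! M\<close>.\<close>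
    have last: "u ! M = 0"
    proof (rule ccontr)
      assume nz: "u ! M \<noteq> 0"
      then have f: "f \<noteq> 0" using sf[of "M - k"] Mk by auto
      then have "t + degree f = M - k"
        using sf[of "t + degree f"] sf_lead by (auto split: if_splits)
      then have deg: "degree f = h" and lead: "lead_coeff f = - (u ! M)"
        using Mk sf[of "t + degree f"] sf_lead by auto
      have top: "coeff f (k - 1) = u ! (K - 1)" using f_top[OF u] by (simp add: f_def)
      show False
      proof (cases "h = k - 1")
        case True
        then have "u ! (K - 1) = - (u ! M)" using top deg lead by simp
        then have "(1 - \<delta>) * u ! M = 0" using E0 by (simp add: E_def algebra_simps)
        then show False using nz \<delta> by simp
      next
        case False
        then have "u ! (K - 1) = 0"
          using top deg dims coeff_eq_0[of f "k - 1"] by simp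
        then show False using nz E0 by (simp add: E_def)
      qed
    qed
    have f: "f = 0"
      using sf[of "t + degree f"] sf_lead last by (simp split: if_splits)
    have S: "block_poly (K + 2 * h) t u = 0" using B0 Z f last by (simp add: B_def f_def)
    show ?thesis
    proof (rule word_eqI[OF u zero_word_in_words])
      fix j assume "j < N"
      then consider "j < K + h" | "K + h \<le> j" "j < K + h + h"
        | "K + 2 * h \<le> j" "j < K + 2 * h + t" | "j = M" using dims unfolding N_def by linarith
      then have "u ! j = 0"
        using info_poly_eq_zeroD[OF f[unfolded f_def]] block_poly_eq_zeroD[OF Z]
          block_poly_eq_zeroD[OF S] last len le
        by cases auto
      then show "u ! j = zero_word N ! j" using \<open>j < N\<close> by simp
    qed
  qed
  have B_info: "B u = s * info_poly h K u" and E_info: "E u = \<delta> * coeff (info_poly h K u) (k - 1)"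
    if "u \<in> words N" "\<And>j. K + h \<le> j \<Longrightarrow> j < N \<Longrightarrow> u ! j = 0" for u
  proof -
    have "block_poly (K + 2 * h) t u = 0" "block_poly (K + h) h u = 0"
      using that le by (auto intro!: block_poly_eq_zero simp: length_in_words)
    moreover have "u ! M = 0" using that dims by (simp add: N_def)
    ultimately show "B u = s * info_poly h K u" "E u = \<delta> * coeff (info_poly h K u) (k - 1)"
      using f_top[OF that(1)] by (simp_all add: B_def E_def)
  qed
  have "css_encoding p e \<gamma> N K h (t + 1) (N + 1 - k) enc"
  proof unfold_locales
    show "N = K + 2 * h + (t + 1)" by (simp add: N_def dims)
    show "inj_on enc (words N)"
      using enc_words enc_add enc_scale kernel by (rule inj_on_words_if_kernel_trivial)
  next
    fix u :: "'a list"
    assume u: "u \<in> words N" and u0: "\<And>j. K + h \<le> j \<Longrightarrow> j < N \<Longrightarrow> u ! j = 0"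
      and wt: "error_weight N (enc u) (zero_word N) < N + 1 - k"
    let ?f = "info_poly h K u"
    let ?Z = "{i. i < N \<and> enc u ! i = 0}"
    have "error_weight N (enc u) (zero_word N) = card ({..<N} - ?Z)"
      unfolding error_weight_def by (rule arg_cong[where f = card]) auto
    also have "\<dots> = N - card ?Z"
      by (subst card_Diff_subset) auto
    finally have Z: "k \<le> card ?Z" using wt k by linarith
    have "?f = 0"
    proof (rule ccontr)
      assume nz: "?f \<noteq> 0"
      have zero: "poly ?f (pts i) = 0" if "i \<in> ?Z - {M}" for i
        using that s_roots[of i] enc_nth[of i u] B_info[OF u u0] by (auto simp: N_def)
      have "inj_on pts (?Z - {M})" using pts by (rule inj_on_subset) (auto simp: N_def)
      \<comment> \<open>A zero at infinity kills the coefficient at \<open>k - 1\<close>, so it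
        costs one degree just as an affine zero does.\<close>
      then have few: "card (?Z - {M}) \<le> degree ?f"
        using poly_eq_zero_if_many_roots[of pts "?Z - {M}" ?f] zero nz by fastforce
      show False
      proof (cases "M \<in> ?Z")
        case True
        then have "coeff ?f (k - 1) = 0"
          using enc_nth[of M u] E_info[OF u u0] \<delta> by auto
        moreover have "degree ?f = k - 1"
          using few True Z f_degree[OF u] by (simp add: card_Diff_singleton)
        ultimately show False using nz by (metis leading_coeff_0_iff)
      next
        case False
        then show False using few Z f_degree[OF u] by simp
      qed
    qed
    then have "enc u = zero_word N"
      by (intro word_eqI[of _ N]) (simp_all add: enc_words enc_nth B_info[OF u u0] E_info[OF u u0])
    then show "u = zero_word N" using kernel u by blast
  next
    fix b :: "'a list"
    assume b: "b \<in> words N" "b \<noteq> zero_word N"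
      and wt: "error_weight N (zero_word N) b < N + 1 - k"
    let ?S = "{i. i < M \<and> b ! i \<noteq> 0}"
    have wt_eq: "error_weight N (zero_word N) b = card {i. i < N \<and> b ! i \<noteq> 0}"
      unfolding error_weight_def by (rule arg_cong[where f = card]) auto
    have "\<exists>g. degree g \<le> M - k \<and> (\<Sum>i<M. b ! i * poly g (pts i)) + b ! M * coeff g (M - k) \<noteq> 0"
    proof (cases "b ! M = 0")
      case True
      obtain i0 where i0N: "i0 < N" "b ! i0 \<noteq> 0"
        using word_eqI[OF b(1) zero_word_in_words] b(2) by auto
      moreover from i0N have "i0 \<noteq> M" using True by auto
      ultimately have i0: "i0 < M" "b ! i0 \<noteq> 0" by (simp_all add: N_def)
      let ?g = "\<Prod>i\<in>?S - {i0}. [:- pts i, 1:]"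
      have "{i. i < N \<and> b ! i \<noteq> 0} = ?S" using True by (auto simp: N_def less_Suc_eq)
      then have "degree ?g \<le> M - k"
        using wt wt_eq i0 k by (simp add: degree_prod_linear N_def)
      then show ?thesis
        using annihilator_of_support[OF pts, of i0 b] i0 True by (intro exI[of _ ?g]) simp
    next
      case False
      \<comment> \<open>All affine terms vanish and only infinity remains. The power of the variable
        pads the degree to exactly \<open>M - k\<close>, the coefficient that infinity
        reads.\<close>
      let ?p = "\<Prod>i\<in>?S. [:- pts i, 1:]"
      let ?m = "M - k - card ?S"
      let ?g = "monom 1 ?m * ?p"
      have "{i. i < N \<and> b ! i \<noteq> 0} = insert M ?S" using False by (auto simp: N_def)
      then have S: "card ?S \<le> M - k" using wt wt_eq k by (simp add: N_def)
      have "?p \<noteq> 0" using lead_coeff_prod_linear[of pts ?S] by auto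
      then have "degree ?g = M - k"
        using S by (simp add: degree_mult_eq degree_monom_eq degree_prod_linear)
      moreover have "lead_coeff ?g = 1"
        unfolding lead_coeff_mult lead_coeff_prod_linear by (simp add: degree_monom_eq)
      moreover have "(\<Sum>i<M. b ! i * poly ?g (pts i)) = 0"
        by (intro sum.neutral) (auto simp: poly_prod prod_zero_iff)
      ultimately show ?thesis using False by (intro exI[of _ ?g]) simp
    qed
    then obtain g where g: "degree g \<le> M - k"
      "(\<Sum>i<M. b ! i * poly g (pts i)) + b ! M * coeff g (M - k) \<noteq> 0" by blast
    \<comment> \<open>The coefficient at \<open>M - k\<close> is carried by coordinate
      \<open>M\<close>; the rest has degree below \<open>t + h\<close> and splits under division by
      \<open>s\<close>.\<close>
    define g' where "g' = g - monom (coeff g (M - k)) (M - k)"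
    have g': "coeff g' j = 0" if "degree s + h \<le> j" for j
      using that g(1) s_degree dims coeff_eq_0[of g j] by (auto simp: g'_def coeff_monom)
    define q r where "q = g' div s" and "r = g' mod s"
    have r: "coeff r j = 0" if "t \<le> j" for j
      unfolding r_def using that s_nonzero s_degree by (intro coeff_mod_eq_0) (simp_all add: t_def)
    have q: "coeff q j = 0" if "h \<le> j" for j
      unfolding q_def using s_nonzero g' that by (rule coeff_div_eq_0)
    let ?u = "map (\<lambda>j. if K \<le> j \<and> j < K + h then coeff q (j - K) else if j = M then coeff g (M - k)
      else if K + 2 * h \<le> j then coeff r (j - (K + 2 * h)) else 0) [0..<N]"
    have u: "?u \<in> words N" by (simp add: words_def)
    have "info_poly h K ?u = q"
      using le q dims by (intro poly_eqI) (auto simp: coeff_info_poly)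
    moreover have "block_poly (K + 2 * h) t ?u = r"
      using le r dims by (intro poly_eqI) (auto simp: coeff_block_poly)
    moreover have "block_poly (K + h) h ?u = 0"
      using le dims by (intro block_poly_eq_zero) auto
    moreover have "?u ! M = coeff g (M - k)" using dims(1) lin_nth by simp
    moreover have "?u ! (K - 1) = 0"
    proof -
      have "\<not> K \<le> K - 1" "K - 1 \<noteq> M" "\<not> K + 2 * h \<le> K - 1" using dims by linarith+
      then show ?thesis using lin_nth by simp
    qed
    moreover have "s * q + r = g'" by (simp add: q_def r_def)
    ultimately have "B ?u = g" "E ?u = coeff g (M - k)"
      by (simp_all add: B_def E_def g'_def)
    then have "dot N b (enc ?u) = (\<Sum>i<M. b ! i * poly g (pts i)) + b ! M * coeff g (M - k)"
      by (simp add: dot_def N_def enc_nth[unfolded N_def])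
    then have "dot N b (enc ?u) \<noteq> 0" using g(2) by simp
    moreover have "\<forall>j<N. j < K \<or> K + h \<le> j \<and> j < K + 2 * h \<longrightarrow> ?u ! j = 0"
      using dims by auto
    ultimately show "\<exists>u\<in>words N. (\<forall>j<N. j < K \<or> K + h \<le> j \<and> j < K + 2 * h \<longrightarrow> u ! j = 0) \<and>
        dot N b (enc u) \<noteq> 0"
      using u by blast
  next
    let ?F = "\<Prod>i\<in>{..<k - 1}. [:- pts i, 1:]"
    have F: "degree ?F = k - 1" "coeff ?F (k - 1) = 1"
      using lead_coeff_prod_linear[of pts "{..<k - 1}"] by (simp_all add: degree_prod_linear)
    have "degree ?F < K + h" unfolding F(1) using k dims by linarith
    from info_poly_surj[OF this le(1)]
    obtain u where u: "u \<in> words N" "info_poly h K u = ?F"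
      and u0: "\<And>j. K + h \<le> j \<Longrightarrow> j < N \<Longrightarrow> u ! j = 0"
      by blast
    have last: "u ! (K - 1) = 1" using f_top[OF u(1)] u(2) F by simp
    have "take K u \<noteq> zero_word K"
    proof
      assume "take K u = zero_word K"
      then have "take K u ! (K - 1) = 0" using dims by simp
      then show False using last dims by simp
    qed
    moreover have "u \<noteq> zero_word N" using last lin_nth by auto
    moreover have "error_weight N (enc u) (zero_word N) \<le> card {k - 1..<N}"
    proof (rule error_weight_le)
      have "enc u ! i = 0" if "i < k - 1" for i
      proof -
        have "poly ?F (pts i) = 0" using that by (auto simp: poly_prod intro!: prod_zero)
        moreover have "i < M" "i < N" using that k le by linarith+
        ultimately show ?thesis by (simp add: enc_nth B_info[OF u(1) u0] u(2))
      qed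
      then show "{j. j < N \<and> (enc u ! j, zero_word N ! j) \<noteq> (0, 0)} \<subseteq> {k - 1..<N}"
        by (auto simp: not_less[symmetric])
    qed simp
    ultimately show "\<exists>u\<in>words N. (\<forall>j. K + h \<le> j \<and> j < N \<longrightarrow> u ! j = 0) \<and> u \<noteq> zero_word N \<and>
      (0 < K \<longrightarrow> take K u \<noteq> zero_word K) \<and> error_weight N (enc u) (zero_word N) \<le> N + 1 - k"
      using u u0 k by (intro bexI[of _ u]) auto
  qed (use enc_words enc_add enc_scale in auto)
  from css_encoding.css_EAQECC[OF this] show ?thesis
    using k by (auto simp: K_def t_def N_def Suc_diff_le)
qed

end

section \<open>Parameters\<close>

text \<open>\<open>m\<close> divides \<open>x * y\<close>, and each factor may be replaced by its
  gcd with \<open>m\<close>. For \<open>m = q - 1\<close> this bounds the length \<open>n\<close> by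
  \<open>q - 1\<close>.\<close>

lemma dvd_lcm_imp_le_gcd_mult:
  fixes m x y :: nat
  assumes "m > 0" "m dvd lcm x y" "x > 0" "y > 0"
  shows "m \<le> gcd x m * gcd y m"
proof -
  have "m dvd x * y"
    using assms(2) by (rule dvd_trans) (simp add: lcm_least)
  then have "m dvd gcd (y * x) (y * m)" by (simp add: mult.commute)
  then have "m dvd gcd x m * y" by (metis gcd_mult_distrib_nat mult.commute)
  then have "m dvd gcd (gcd x m * y) (gcd x m * m)" by simp
  also have "\<dots> = gcd x m * gcd y m" by (rule gcd_mult_distrib_nat[symmetric])
  finally show ?thesis using assms by (intro dvd_imp_le) auto
qed

context trace_character
begin

lemma MDS_EAQECC_affine:
  fixes k h N :: nat
  assumes "1 \<le> k" "h \<le> k" "k + h \<le> N" "N \<le> CARD('a)"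
    and "N < CARD('a) \<or> 2 \<le> N - k - h"
  shows "\<exists>Q :: 'a state set. MDS_EAQECC \<gamma> N (k - h) (N + 1 - k) (N - k - h) Q"
proof -
  obtain pts :: "nat \<Rightarrow> 'a" where "bij_betw pts {0..<CARD('a)} UNIV"
    using ex_bij_betw_nat_finite[of "UNIV :: 'a set"] by auto
  then have "inj_on pts {0..<CARD('a)}" by (rule bij_betw_imp_inj_on)
  then have pts: "inj_on pts {..<N}" by (rule inj_on_subset) (use assms(4) in auto)
  have "pts ` {..<N} \<noteq> UNIV \<or> 2 \<le> N - k - h"
    using assms(5) pts by (metis card_image card_lessThan less_irrefl)
  from root_free_poly[OF this] obtain s
    where s: "degree s = N - k - h" "lead_coeff s = 1" "\<forall>x\<in>pts ` {..<N}. poly s x \<noteq> 0"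
    by blast
  have "s \<noteq> 0" using s(2) by auto
  with affine_EAQECC[OF pts assms(1-3) s(1)] s(3) obtain Q :: "'a state set"
    where "EAQECC \<gamma> N (k - h) (N + 1 - k) (N - k - h) Q" by auto
  then have "MDS_EAQECC \<gamma> N (k - h) (N + 1 - k) (N - k - h) Q"
    using assms by (simp add: MDS_EAQECC_def of_nat_diff)
  then show ?thesis by blast
qed

lemma MDS_EAQECC_projective:
  fixes k h :: nat
  assumes "h < k" "k + h + 2 \<le> CARD('a)" "2 < CARD('a)"
  shows "\<exists>Q :: 'a state set. MDS_EAQECC \<gamma> (CARD('a) + 1) (k - h) (CARD('a) + 2 - k) (CARD('a) + 1 - k - h) Q"
proof -
  obtain pts :: "nat \<Rightarrow> 'a" where "bij_betw pts {0..<CARD('a)} UNIV"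
    using ex_bij_betw_nat_finite[of "UNIV :: 'a set"] by auto
  then have pts: "inj_on pts {..<CARD('a)}"
    unfolding lessThan_atLeast0 by (rule bij_betw_imp_inj_on)
  have "UNIV \<noteq> (UNIV :: 'a set) \<or> 2 \<le> CARD('a) - k - h" using assms by simp
  from root_free_poly[OF this] obtain s :: "'a poly"
    where s: "degree s = CARD('a) - k - h" "lead_coeff s = 1" "\<forall>x\<in>UNIV. poly s x \<noteq> 0"
    by blast
  \<comment> \<open>A third field element supplies \<delta>.\<close>
  have "card {0, 1 :: 'a} < CARD('a)" using assms(3) by simp
  then have "{0, 1 :: 'a} \<noteq> UNIV" by (metis less_irrefl)
  then obtain \<delta> :: 'a where "\<delta> \<noteq> 0" "\<delta> \<noteq> 1" by blast
  with projective_EAQECC[OF pts assms(1) _ s(1,2)] s(3) assms obtain Q :: "'a state set"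
    where "EAQECC \<gamma> (CARD('a) + 1) (k - h) (CARD('a) + 2 - k) (CARD('a) + 1 - k - h) Q" by auto
  then have "MDS_EAQECC \<gamma> (CARD('a) + 1) (k - h) (CARD('a) + 2 - k) (CARD('a) + 1 - k - h) Q"
    using assms by (simp add: MDS_EAQECC_def of_nat_diff)
  then show ?thesis by blast
qed

end

theorem theorem7:
  fixes p e q l x1 x2 r n k :: nat and \<gamma> :: complex
  assumes "prime p" and "odd p" and "e \<ge> 1" and "q = p ^ e"
    and "CARD('a::{finite,field}) = q"
    and "primitive_root_of_unity p \<gamma>"
    and "l \<le> e - 1" and "2 * l dvd e"
    and "x1 > 0" and "x2 > 0"
    and "(q - 1) dvd lcm x1 x2"
    and "((q - 1) div (p ^ l - 1)) dvd x1"
    and "1 \<le> r" and "r \<le> (q - 1) div gcd x1 (q - 1)"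
    and "n = (r * (q - 1)) div gcd x2 (q - 1)"
    and "1 \<le> k" and "k \<le> nat \<lfloor>real (p ^ l + n) / real (p ^ l + 1)\<rfloor>"
  shows "(\<forall>h. h \<le> k - 1 \<longrightarrow>
            (\<exists>Q :: 'a state set. MDS_EAQECC \<gamma> n (k - h) (n + 1 - k) (n - k - h) Q))
       \<and> (\<forall>h. h \<le> k \<longrightarrow>
            (\<exists>Q :: 'a state set. MDS_EAQECC \<gamma> (n + 1) (k - h) (n + 2 - k) (n + 1 - k - h) Q))
       \<and> (\<forall>h. h \<le> k - 1 \<longrightarrow>
            (\<exists>Q :: 'a state set. MDS_EAQECC \<gamma> (n + 2) (k - h) (n + 3 - k) (n + 2 - k - h) Q))"
proof -
  interpret trace_character p e \<gamma> "TYPE('a)"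
    using assms by unfold_locales auto
  \<comment> \<open>For \<open>l = 0\<close> the divisor \<open>2 * l\<close> of \<open>e\<close>
    would be 0.\<close>
  have l: "l \<noteq> 0" "2 \<le> e"
    using \<open>2 * l dvd e\<close> \<open>e \<ge> 1\<close> by (auto dest: dvd_imp_le)
  have p3: "3 \<le> p" using \<open>prime p\<close> \<open>odd p\<close>
    by (metis One_nat_def Suc_1 Suc_leI even_numeral le_neq_implies_less numeral_3_eq_3 prime_ge_2_nat)
  have "p ^ 1 \<le> p ^ l" using l p3 by (intro power_increasing) auto
  then have pl: "3 \<le> p ^ l" using p3 by simp
  have "3 ^ 2 \<le> p ^ 2" using p3 by (intro power_mono) auto
  also have "p ^ 2 \<le> p ^ e" using l p3 by (intro power_increasing) auto
  finally have q9: "9 \<le> q" using \<open>q = p ^ e\<close> by simp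
  define m where "m = q - 1"
  have m: "m > 0" using q9 by (simp add: m_def)
  have gs: "gcd x1 m > 0" "gcd x2 m > 0" using m by simp_all
  \<comment> \<open>\<open>a\<close> is the upper bound for \<open>r\<close> and
    \<open>n = r * b\<close>, so n \<le> \<open>a * b\<close>, which is at most
    \<open>q - 1\<close>.\<close>
  obtain a b where ab: "m = gcd x1 m * a" "m = gcd x2 m * b"
    by (meson dvdE gcd_dvd2)
  have "n = r * b"
    using ab(2) gs assms(15) unfolding m_def[symmetric]
    by (metis div_mult_self1_is_m mult.left_commute)
  moreover have "r \<le> a"
    using assms(14) ab(1) gs unfolding m_def[symmetric] by (metis div_mult_self1_is_m)
  moreover have "b > 0" using ab(2) m by (metis gr0I mult_0_right less_irrefl)
  ultimately have n1: "1 \<le> n" and "n \<le> a * b" using assms(13) by auto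
  moreover have "a * b \<le> m"
  proof -
    have "(a * b) * m \<le> (a * b) * (gcd x1 m * gcd x2 m)"
      using dvd_lcm_imp_le_gcd_mult[OF m] assms(9-11) by (intro mult_left_mono) (auto simp: m_def)
    also have "\<dots> = (gcd x1 m * a) * (gcd x2 m * b)" by (simp only: mult_ac)
    also have "\<dots> = m * m" using ab by simp
    finally show ?thesis using m by simp
  qed
  ultimately have nq: "n + 1 \<le> q" using q9 by (simp add: m_def)
  have "real k \<le> real (p ^ l + n) / real (p ^ l + 1)"
    using assms(16,17) by linarith
  moreover have "0 < real (p ^ l + 1)" unfolding of_nat_0_less_iff by simp
  ultimately have "real k * real (p ^ l + 1) \<le> real (p ^ l + n)"
    by (simp only: pos_le_divide_eq)
  then have "real (k * (p ^ l + 1)) \<le> real (p ^ l + n)"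
    by (simp only: of_nat_mult)
  then have "k * (p ^ l + 1) \<le> p ^ l + n" by (simp only: of_nat_le_iff)
  moreover obtain k' where k': "k = Suc k'" using assms(16) by (cases k) auto
  ultimately have "k' * (p ^ l + 1) + 1 \<le> n" by simp
  \<comment> \<open>The factor 4 is the least value of \<open>p ^ l + 1\<close>, as \<open>p\<close>
    is odd and \<open>l\<close> positive.\<close>
  moreover have "k' * 4 \<le> k' * (p ^ l + 1)" using pl by (intro mult_left_mono) auto
  ultimately have "k' * 4 + 1 \<le> n" by (meson add_le_mono1 order_trans)
  then have kn: "4 * k \<le> n + 3" unfolding k' by simp
  show ?thesis
  proof (intro conjI allI impI)
    fix h assume h: "h \<le> k - 1"
    show "\<exists>Q :: 'a state set. MDS_EAQECC \<gamma> n (k - h) (n + 1 - k) (n - k - h) Q"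
      using h kn nq assms(5,16) by (intro MDS_EAQECC_affine) auto
    show "\<exists>Q :: 'a state set. MDS_EAQECC \<gamma> (n + 2) (k - h) (n + 3 - k) (n + 2 - k - h) Q"
    \<comment> \<open>Length \<open>n + 2\<close> exceeds \<open>q\<close> only here, where it is
      \<open>q + 1\<close> and infinity is needed. At length exactly \<open>q\<close>, 4k \<le> n +
      3 and q \<ge> 9 make the degree of \<open>s\<close> at least 2.\<close>
    proof (cases "n + 1 = q")
      case True
      then have "CARD('a) = n + 1" using assms(5) by simp
      then show ?thesis
        using MDS_EAQECC_projective[of h k] h kn q9 True assms(16) by (simp add: numeral_eq_Suc)
    next
      case False
      then have "n + 2 < CARD('a) \<or> 2 \<le> n + 2 - k - h" "n + 2 \<le> CARD('a)" "h \<le> k" "k + h \<le> n + 2"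
        using h kn nq q9 assms(5,16) by presburger+
      then show ?thesis
        using MDS_EAQECC_affine[of k h "n + 2"] assms(16) by (simp add: numeral_eq_Suc)
    qed
  next
    fix h assume h: "h \<le> k"
    then have "n + 1 < CARD('a) \<or> 2 \<le> n + 1 - k - h" "n + 1 \<le> CARD('a)" "k + h \<le> n + 1"
      using kn nq q9 assms(5,16) by presburger+
    then show "\<exists>Q :: 'a state set. MDS_EAQECC \<gamma> (n + 1) (k - h) (n + 2 - k) (n + 1 - k - h) Q"
      using MDS_EAQECC_affine[of k h "n + 1"] h assms(16) by (simp add: numeral_eq_Suc)
  qed
qed

end
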